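(* Let $n=3$ and let $p\in\mathbb R[x,y]$ be a biquadratic form which is nonnegative on $V(I)=\{(x,y)\in\mathbb R^3\times\mathbb R^3: y^Tx=0\}$. Assume that either there exist a nonzero vector $v_0\in\mathbb R^3$ and two linearly independent vectors $w_1,w_2\in\mathbb R^3$ orthogonal to $v_0$ such that $p(v_0,w_1)=p(v_0,w_2)=0$, or there exist a nonzero vector $w_0\in\mathbb R^3$ and two linearly independent vectors $v_1,v_2\in\mathbb R^3$ orthogonal to $w_0$ such that $p(v_1,w_0)=p(v_2,w_0)=0$. Then $p\in\sum\mathbb R[x,y]^2+I$.
   Context: $x=(x_1,x_2,x_3)$, $y=(y_1,y_2,y_3)$. A biquadratic form is a polynomial homogeneous of degree $2$ in $x$ and homogeneous of degree $2$ in $y$. $I\subseteq\mathbb R[x,y]$ is the ideal generated by $x_1y_1+x_2y_2+x_3y_3$. $\sum\mathbb R[x,y]^2$ is the set of finite sums of squares of polynomials in $\mathbb R[x,y]$. *)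

theory Defs
  imports "HOL-Analysis.Analysis" "HOL-Library.Poly_Mapping"
begin

text \<open>The variable set is \<open>3 + 3\<close>: \<open>Inl i\<close> is \<open>x\<^sub>i\<close> and \<open>Inr i\<close> is \<open>y\<^sub>i\<close>.
  A monomial is its exponent vector, and a polynomial is a finitely supported map from
  monomials to coefficients; multiplication is the convolution product of \<open>Poly_Mapping\<close>.\<close>

type_synonym monom_xy = "(3 + 3) \<Rightarrow>\<^sub>0 nat"
type_synonym poly_xy = "monom_xy \<Rightarrow>\<^sub>0 real"

definition var_x :: "3 \<Rightarrow> poly_xy" where
  "var_x i = Poly_Mapping.single (Poly_Mapping.single (Inl i) 1) 1"

definition var_y :: "3 \<Rightarrow> poly_xy" where
  "var_y i = Poly_Mapping.single (Poly_Mapping.single (Inr i) 1) 1"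

definition monom_eval :: "monom_xy \<Rightarrow> real^3 \<Rightarrow> real^3 \<Rightarrow> real" where
  "monom_eval m v w =
     (\<Prod>i\<in>UNIV. (v $ i) ^ Poly_Mapping.lookup m (Inl i)) *
     (\<Prod>i\<in>UNIV. (w $ i) ^ Poly_Mapping.lookup m (Inr i))"

definition poly_eval :: "poly_xy \<Rightarrow> real^3 \<Rightarrow> real^3 \<Rightarrow> real" where
  "poly_eval p v w =
     (\<Sum>m\<in>Poly_Mapping.keys p. Poly_Mapping.lookup p m * monom_eval m v w)"

definition biquadratic_form :: "poly_xy \<Rightarrow> bool" where
  "biquadratic_form p \<longleftrightarrow>
     (\<forall>m\<in>Poly_Mapping.keys p.
        (\<Sum>i\<in>UNIV. Poly_Mapping.lookup m (Inl i)) = 2 \<and>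
        (\<Sum>i\<in>UNIV. Poly_Mapping.lookup m (Inr i)) = 2)"

text \<open>Ideals of a commutative ring are its submodules over itself.\<close>

lemma module_times: "module ((*) :: 'a::comm_ring_1 \<Rightarrow> 'a \<Rightarrow> 'a)"
  by (rule module.intro) (simp_all add: algebra_simps)

definition ideal_generated :: "'a::comm_ring_1 set \<Rightarrow> 'a set" where
  "ideal_generated S = module.span (*) S"

definition ideal_I :: "poly_xy set" where
  "ideal_I = ideal_generated {\<Sum>i\<in>UNIV. var_x i * var_y i}"

definition variety :: "poly_xy set \<Rightarrow> ((real^3) \<times> (real^3)) set" where
  "variety J = {(v, w). \<forall>q\<in>J. poly_eval q v w = 0}"

definition sums_of_squares :: "'a::comm_ring_1 set" where
  "sums_of_squares = {(\<Sum>i<k. f i ^ 2) | (f :: nat \<Rightarrow> 'a) (k :: nat). True}"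

lemma ideal_I_eq: "ideal_I = range (\<lambda>q. q * (\<Sum>i\<in>UNIV. var_x i * var_y i))"
  unfolding ideal_I_def ideal_generated_def by (rule module.span_singleton[OF module_times])

lemma monom_eval_add: "monom_eval (m + n) v w = monom_eval m v w * monom_eval n v w"
  by (simp add: monom_eval_def lookup_add power_add prod.distrib)

lemma poly_eval_superset:
  assumes "finite A" "Poly_Mapping.keys p \<subseteq> A"
  shows "poly_eval p v w = (\<Sum>m\<in>A. Poly_Mapping.lookup p m * monom_eval m v w)"
  unfolding poly_eval_def using assms
  by (intro sum.mono_neutral_left) (auto simp: in_keys_iff)

lemma poly_eval_zero [simp]: "poly_eval 0 v w = 0"
  by (simp add: poly_eval_def)

lemma poly_eval_add: "poly_eval (p + q) v w = poly_eval p v w + poly_eval q v w"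
proof -
  let ?A = "Poly_Mapping.keys p \<union> Poly_Mapping.keys q"
  have "poly_eval r v w = (\<Sum>m\<in>?A. Poly_Mapping.lookup r m * monom_eval m v w)"
    if "r \<in> {p, q, p + q}" for r
    using that keys_add[of p q] by (intro poly_eval_superset) auto
  then show ?thesis
    by (simp add: lookup_add distrib_right sum.distrib)
qed

lemma poly_eval_sum: "poly_eval (sum f A) v w = (\<Sum>a\<in>A. poly_eval (f a) v w)"
  by (induction A rule: infinite_finite_induct) (simp_all add: poly_eval_add)

lemma poly_eval_single: "poly_eval (Poly_Mapping.single m c) v w = c * monom_eval m v w"
  by (simp add: poly_eval_def)

lemma poly_xy_expand:
  "p = (\<Sum>m\<in>Poly_Mapping.keys p. Poly_Mapping.single m (Poly_Mapping.lookup p m))"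
  by (rule poly_mapping_eqI)
     (auto simp: lookup_sum lookup_single when_def in_keys_iff)

lemma poly_eval_mult: "poly_eval (p * q) v w = poly_eval p v w * poly_eval q v w"
proof -
  have "p * q = (\<Sum>m\<in>Poly_Mapping.keys p. \<Sum>n\<in>Poly_Mapping.keys q.
      Poly_Mapping.single (m + n) (Poly_Mapping.lookup p m * Poly_Mapping.lookup q n))"
    by (subst (1) poly_xy_expand[of p], subst (1) poly_xy_expand[of q])
       (simp add: sum_product mult_single)
  then show ?thesis
    by (simp add: poly_eval_sum poly_eval_single monom_eval_add)
       (simp add: poly_eval_def sum_product mult_ac)
qed

lemma poly_eval_var_x [simp]: "poly_eval (var_x i) v w = v $ i"
  unfolding var_x_def poly_eval_single monom_eval_def
  by (simp add: lookup_single when_def power_0_left if_distrib[of "(^) _"] cong: if_cong)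

lemma poly_eval_var_y [simp]: "poly_eval (var_y i) v w = w $ i"
  unfolding var_y_def poly_eval_single monom_eval_def
  by (simp add: lookup_single when_def power_0_left if_distrib[of "(^) _"] cong: if_cong)

lemma variety_ideal_I: "variety ideal_I = {(v, w). w \<bullet> v = 0}"
proof -
  let ?g = "\<Sum>i\<in>UNIV. var_x i * var_y i"
  have g: "poly_eval ?g v w = w \<bullet> v" for v w
    by (simp add: poly_eval_sum poly_eval_mult inner_vec_def mult.commute)
  have "(\<forall>q\<in>ideal_I. poly_eval q v w = 0) \<longleftrightarrow> w \<bullet> v = 0" for v w
  proof
    assume *: "\<forall>q\<in>ideal_I. poly_eval q v w = 0"
    have "1 * ?g \<in> ideal_I" unfolding ideal_I_eq by (rule rangeI)
    with * have "poly_eval (1 * ?g) v w = 0" by blast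
    then show "w \<bullet> v = 0" by (simp add: g)
  next
    assume "w \<bullet> v = 0"
    then show "\<forall>q\<in>ideal_I. poly_eval q v w = 0"
      by (auto simp: ideal_I_eq poly_eval_mult g)
  qed
  then show ?thesis by (simp add: variety_def)
qed

end

theory Submission
  imports Defs "HOL-Computational_Algebra.Polynomial"
begin

text \<open>By the symmetry between \<open>x\<close> and \<open>y\<close> suppose that \<open>p(v\<^sub>0, _)\<close> has two independent zeros in
  the plane orthogonal to \<open>v\<^sub>0\<close>. It is a nonnegative quadratic form on that plane, so it vanishes
  there. A rotation, which preserves \<open>y\<^sup>Tx\<close>, makes \<open>v\<^sub>0\<close> the first unit vector, and then \<open>p\<close> has
  no terms \<open>x\<^sub>1\<^sup>2 y\<^sub>j y\<^sub>k\<close> with \<open>j, k \<ge> 2\<close>. Modulo \<open>I\<close> the product \<open>x\<^sub>1 y\<^sub>1\<close> may be replaced by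
  \<open>- (x\<^sub>2 y\<^sub>2 + x\<^sub>3 y\<^sub>3)\<close>, which turns \<open>p\<close> into \<open>x\<^sub>1 T(x\<^sub>2, x\<^sub>3; y\<^sub>2, y\<^sub>3) + Q(x\<^sub>2, x\<^sub>3; y)\<close>. On
  the variety \<open>x\<^sub>1\<close> can be made arbitrarily large of either sign, with \<open>y\<^sub>1 = - (x\<^sub>2 y\<^sub>2 + x\<^sub>3 y\<^sub>3) / x\<^sub>1\<close>
  tending to \<open>0\<close>, so nonnegativity forces \<open>T = 0\<close>. Whenever \<open>y\<^sub>1 \<noteq> 0\<close>, the equation of the variety
  can be solved for \<open>x\<^sub>1\<close>, so \<open>Q\<close> is nonnegative for all \<open>x\<^sub>2, x\<^sub>3, y\<close>
  (\<open>sos_modulo_pairing_axis\<close>).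

  A nonnegative biquadratic form in \<open>2 \<times> n\<close> variables is a sum of squares of bilinear forms
  (Calderon's theorem, \<open>psd_pencil_sum_of_squares\<close>). Normalize it to trace one. If it were not such
  a sum, a linear functional would separate it from
  the convex hull of the squares \<open>(s (a \<bullet> y) + t (b \<bullet> y))\<^sup>2\<close> with \<open>\<bar>a\<bar>\<^sup>2 + \<bar>b\<bar>\<^sup>2 = 1\<close>, which is
  compact. This functional can be taken positive on all nonzero squares. Simultaneous diagonalization
  of two of its blocks writes it as a sum of point evaluations at
  \<open>(s, t; y) = (1, d\<^sub>a; u\<^sub>a)\<close> plus a functional that sees only the coefficient of \<open>t\<^sup>2\<close> and is
  nonnegative on positive semidefinite forms; hence it is nonnegative on every nonnegative
  biquadratic form, a contradiction (\<open>positive_functional_nonneg\<close>).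

  All of this takes place among real functions built from bilinear maps, where rotating and exchanging
  the two arguments cost nothing. The identity found there becomes an identity of polynomials because
  a polynomial is determined by its values (\<open>poly_eval_inject\<close>).\<close>

section \<open>Simultaneous diagonalization\<close>

lemma zero_if_linear_below_square:
  fixes a b :: real
  assumes "\<And>t. a * t \<le> b * t\<^sup>2"
  shows "a = 0"
proof (rule ccontr)
  assume "a \<noteq> 0"
  define c where "c = \<bar>b\<bar> + 1"
  have c: "c > 0" "b < c" by (auto simp: c_def)
  have "a * (a / c) \<le> b * (a / c)\<^sup>2" by (rule assms)
  then have "a\<^sup>2 * c \<le> a\<^sup>2 * b"
    using c by (simp add: field_simps power2_eq_square)
  moreover have "a\<^sup>2 > 0" using \<open>a \<noteq> 0\<close> by simp
  ultimately show False using c by simp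
qed

text \<open>Induction on the dimension. A vector \<open>v\<close> maximizing the quotient \<open>h x x / g x x\<close> on \<open>S\<close> is
  critical for it, so every \<open>u\<close> that is \<open>g\<close>-orthogonal to \<open>v\<close> is also \<open>h\<close>-orthogonal to \<open>v\<close>, and the
  induction continues on the \<open>g\<close>-orthogonal complement of \<open>v\<close>. Allowing an arbitrary inner product
  \<open>g\<close> makes one statement serve both for pairs of forms and for the usual spectral theorem.\<close>

lemma simultaneous_orthonormal_basis:
  fixes g h :: "'a::euclidean_space \<Rightarrow> 'a \<Rightarrow> real"
  assumes g: "bilinear g" "\<And>x y. g x y = g y x" "\<And>x. x \<noteq> 0 \<Longrightarrow> g x x > 0"
    and h: "bilinear h" "\<And>x y. h x y = h y x"
    and S: "subspace S"
  shows "\<exists>B. finite B \<and> B \<subseteq> S \<and> (\<forall>x\<in>S. x = (\<Sum>b\<in>B. g b x *\<^sub>R b)) \<and>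
    (\<forall>a\<in>B. \<forall>b\<in>B. g a b = (if a = b then 1 else 0)) \<and>
    (\<forall>a\<in>B. \<forall>b\<in>B. a \<noteq> b \<longrightarrow> h a b = 0)"
  using S
proof (induction "dim S" arbitrary: S rule: less_induct)
  case less
  note g_simps = bilinear_ladd[OF g(1)] bilinear_radd[OF g(1)] bilinear_lmul[OF g(1)]
    bilinear_rmul[OF g(1)] bilinear_rsub[OF g(1)] bilinear_lsub[OF g(1)]
    bilinear_lzero[OF g(1)] bilinear_rzero[OF g(1)]
  note h_simps = bilinear_ladd[OF h(1)] bilinear_radd[OF h(1)] bilinear_lmul[OF h(1)]
    bilinear_rmul[OF h(1)] bilinear_lzero[OF h(1)] bilinear_rzero[OF h(1)]
  show ?case
  proof (cases "S \<subseteq> {0}")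
    case True
    then show ?thesis by (intro exI[of _ "{}"]) auto
  next
    case False
    then obtain s where s: "s \<in> S" "s \<noteq> 0" by auto
    define K where "K = S \<inter> sphere 0 1"
    have "compact K"
      unfolding K_def using closed_subspace[OF less.prems] compact_sphere
      by (simp add: closed_Int_compact)
    moreover have "s /\<^sub>R norm s \<in> K"
      using s less.prems by (simp add: K_def subspace_scale)
    moreover have "continuous_on K (\<lambda>x. h x x / g x x)"
    proof -
      have "g x x \<noteq> 0" if "x \<in> K" for x
      proof -
        have "x \<noteq> 0" using that by (auto simp: K_def)
        then show ?thesis using g(3)[of x] by simp
      qed
      then show ?thesis
        by (intro continuous_intros bilinear_continuous_on_compose[OF _ _ g(1)]
          bilinear_continuous_on_compose[OF _ _ h(1)]) auto
    qed
    ultimately obtain v0 where v0: "v0 \<in> K"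
        and max: "\<And>x. x \<in> K \<Longrightarrow> h x x / g x x \<le> h v0 v0 / g v0 v0"
      using continuous_attains_sup[of K "\<lambda>x. h x x / g x x"] by blast
    have "v0 \<in> S" "v0 \<noteq> 0" using v0 by (auto simp: K_def)
    then have gv0: "g v0 v0 > 0" using g(3) by blast
    define v where "v = v0 /\<^sub>R sqrt (g v0 v0)"
    have vS: "v \<in> S" using \<open>v0 \<in> S\<close> less.prems by (simp add: v_def subspace_scale)
    have gv: "g v v = 1" using gv0 by (simp add: v_def g_simps field_simps)
    have hv: "h v v = h v0 v0 / g v0 v0" using gv0 by (simp add: v_def h_simps field_simps)
    have bound: "h x x \<le> h v v * g x x" if "x \<in> S" for x
    proof (cases "x = 0")
      case True
      then show ?thesis by (simp add: g_simps h_simps)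
    next
      case False
      have "x /\<^sub>R norm x \<in> K"
        using that False less.prems by (simp add: K_def subspace_scale)
      from max[OF this] have "h x x / g x x \<le> h v v"
        using False by (simp add: g_simps h_simps hv)
      then show ?thesis using g(3)[OF False] by (simp add: field_simps)
    qed
    have crit: "h u v = 0" if u: "u \<in> S" "g u v = 0" for u
    proof -
      have "(2 * h u v) * t \<le> (h v v * g u u - h u u) * t\<^sup>2" for t
      proof -
        have "v + t *\<^sub>R u \<in> S" using u vS less.prems by (simp add: subspace_add subspace_scale)
        from bound[OF this] have "h v v + 2 * t * h u v + t\<^sup>2 * h u u \<le> h v v * (1 + t\<^sup>2 * g u u)"
          using u gv h(2)[of v u] g(2)[of v u]
          by (simp add: g_simps h_simps power2_eq_square algebra_simps)
        then show ?thesis by (simp add: algebra_simps)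
      qed
      then show ?thesis using zero_if_linear_below_square by fastforce
    qed
    define S' where "S' = {u \<in> S. g u v = 0}"
    have sub': "subspace S'"
      using less.prems by (auto simp: S'_def subspace_def g_simps)
    have "v \<notin> S'" using gv by (simp add: S'_def)
    with vS have "S' \<noteq> S" by blast
    moreover have "S' \<subseteq> S" by (auto simp: S'_def)
    ultimately have "dim S' < dim S"
      using subspace_dim_equal[OF sub' less.prems] dim_subset[of S' S] by linarith
    from less.hyps[OF this sub'] obtain B where B: "finite B" "B \<subseteq> S'"
      "\<forall>x\<in>S'. x = (\<Sum>b\<in>B. g b x *\<^sub>R b)"
      "\<forall>a\<in>B. \<forall>b\<in>B. g a b = (if a = b then 1 else 0)"
      "\<forall>a\<in>B. \<forall>b\<in>B. a \<noteq> b \<longrightarrow> h a b = 0" by blast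
    have Bv: "g b v = 0" "h b v = 0" "b \<in> S" "g v b = 0" "h v b = 0" if "b \<in> B" for b
      using that B(2) crit g(2) h(2) by (auto simp: S'_def subset_iff)
    have "v \<notin> B" using Bv gv by force
    have "x = (\<Sum>b\<in>insert v B. g b x *\<^sub>R b)" if "x \<in> S" for x
    proof -
      have "x - g v x *\<^sub>R v \<in> S'"
        using that vS less.prems gv g(2)[of x v] 
        by (simp add: S'_def subspace_diff subspace_scale g_simps)
      then have "x - g v x *\<^sub>R v = (\<Sum>b\<in>B. g b (x - g v x *\<^sub>R v) *\<^sub>R b)"
        using B(3) by blast
      also have "\<dots> = (\<Sum>b\<in>B. g b x *\<^sub>R b)"
        by (intro sum.cong) (auto simp: g_simps Bv)
      finally show ?thesis using \<open>v \<notin> B\<close> B(1) by (simp add: algebra_simps)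
    qed
    then show ?thesis
      using B Bv \<open>v \<notin> B\<close> gv vS by (intro exI[of _ "insert v B"]) auto
  qed
qed

definition outer :: "real^'n \<Rightarrow> real^'n \<Rightarrow> real^'n^'n" where
  "outer a b = (\<chi> i j. a $ i * b $ j)"

lemma outer_mult_vec: "outer a b *v x = (b \<bullet> x) *\<^sub>R a"
  by (simp add: outer_def matrix_vector_mult_def inner_vec_def vec_eq_iff sum_distrib_left mult_ac)

lemma inner_outer: "M \<bullet> outer a b = a \<bullet> (M *v b)"
  by (simp add: outer_def inner_vec_def matrix_vector_mult_def sum_distrib_left mult_ac)

lemma outer_inner: "outer a b \<bullet> M = a \<bullet> (M *v b)"
  by (metis inner_commute inner_outer)

lemma transpose_outer: "transpose (outer a b) = outer b a"
  by (simp add: outer_def transpose_def vec_eq_iff mult_ac)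

lemma inner_transpose: "transpose M \<bullet> transpose N = M \<bullet> (N :: real^'n^'m)"
  unfolding inner_vec_def transpose_def by (simp, rule sum.swap)

lemma inner_symmetric_matrix:
  fixes M :: "real^'n^'n"
  assumes "transpose M = M"
  shows "x \<bullet> (M *v y) = y \<bullet> (M *v x)"
  by (metis assms dot_lmul_matrix inner_commute vector_transpose_matrix)

lemma bilinear_matrix_form:
  fixes M :: "real^'n^'n"
  shows "bilinear (\<lambda>x y. x \<bullet> (M *v y))"
  by (auto simp: bilinear_def linear_iff inner_add_left inner_add_right
      matrix_vector_right_distrib matrix_vector_mult_scaleR)

lemma sum_matrix_vector_mult: "(\<Sum>a\<in>B. M a) *v x = (\<Sum>a\<in>B. M a *v (x :: real^'n))"
  by (induction B rule: infinite_finite_induct) (auto simp: matrix_vector_mult_add_rdistrib)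

lemma scaleR_matrix_vector: "(c *\<^sub>R M) *v (x :: real^'n) = c *\<^sub>R (M *v x)"
  by (simp add: matrix_vector_mult_def vec_eq_iff sum_distrib_left mult_ac)

text \<open>The vectors \<open>a \<in> B\<close> form a \<open>G\<close>-orthonormal basis and the vectors \<open>G *v a\<close> its dual basis, in which
  both matrices are diagonal.\<close>

lemma simultaneous_diagonalization:
  fixes G H :: "real^'n^'n"
  assumes G: "transpose G = G" "\<And>x. x \<noteq> 0 \<Longrightarrow> x \<bullet> (G *v x) > 0" and H: "transpose H = H"
  obtains B where "finite B"
    "\<And>a b. a \<in> B \<Longrightarrow> b \<in> B \<Longrightarrow> a \<bullet> (G *v b) = (if a = b then 1 else 0)"
    "G = (\<Sum>a\<in>B. outer (G *v a) (G *v a))"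
    "H = (\<Sum>a\<in>B. (a \<bullet> (H *v a)) *\<^sub>R outer (G *v a) (G *v a))"
proof -
  obtain B where B: "finite B" "\<And>x. x = (\<Sum>b\<in>B. (b \<bullet> (G *v x)) *\<^sub>R b)"
    "\<And>a b. a \<in> B \<Longrightarrow> b \<in> B \<Longrightarrow> a \<bullet> (G *v b) = (if a = b then 1 else 0)"
    "\<And>a b. a \<in> B \<Longrightarrow> b \<in> B \<Longrightarrow> a \<noteq> b \<Longrightarrow> a \<bullet> (H *v b) = 0"
    using simultaneous_orthonormal_basis[OF bilinear_matrix_form
        inner_symmetric_matrix[OF G(1)] G(2) bilinear_matrix_form
        inner_symmetric_matrix[OF H] subspace_UNIV, simplified]
    by blast
  have expand: "M *v x = (\<Sum>b\<in>B. (b \<bullet> (G *v x)) *\<^sub>R (M *v b))" for x and M :: "real^'n^'n"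
    by (subst B(2)[of x])
      (simp add: linear_sum[OF matrix_vector_mul_linear] matrix_vector_mult_scaleR)
  have coeff: "(G *v a) \<bullet> x = a \<bullet> (G *v x)" for a x
    by (metis inner_commute inner_symmetric_matrix[OF G(1)])
  have "G *v x = (\<Sum>a\<in>B. outer (G *v a) (G *v a)) *v x" for x
    by (simp add: sum_matrix_vector_mult outer_mult_vec coeff expand[of G x, symmetric])
  then have G_eq: "G = (\<Sum>a\<in>B. outer (G *v a) (G *v a))" unfolding matrix_eq by blast
  have Hb: "H *v b = (b \<bullet> (H *v b)) *\<^sub>R (G *v b)" if "b \<in> B" for b
  proof -
    have "x \<bullet> (H *v b) = x \<bullet> ((b \<bullet> (H *v b)) *\<^sub>R (G *v b))" for x
    proof -
      have "x \<bullet> (H *v b) = (\<Sum>a\<in>B. (a \<bullet> (G *v x)) * (a \<bullet> (H *v b)))"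
        by (subst B(2)[of x]) (simp add: inner_sum_left)
      also have "\<dots> = (\<Sum>a\<in>B. if a = b then (b \<bullet> (G *v x)) * (b \<bullet> (H *v b)) else 0)"
        by (intro sum.cong) (auto simp: B(4) that)
      also have "\<dots> = (b \<bullet> (G *v x)) * (b \<bullet> (H *v b))" using B(1) that by simp
      also have "b \<bullet> (G *v x) = x \<bullet> (G *v b)" by (rule inner_symmetric_matrix[OF G(1)])
      finally show ?thesis by simp
    qed
    then show ?thesis by (metis vector_eq_rdot inner_commute)
  qed
  have "H *v x = (\<Sum>a\<in>B. (a \<bullet> (H *v a)) *\<^sub>R outer (G *v a) (G *v a)) *v x" for x
  proof -
    have "H *v x = (\<Sum>a\<in>B. (a \<bullet> (G *v x)) *\<^sub>R (a \<bullet> (H *v a)) *\<^sub>R (G *v a))"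
      unfolding expand[of H x] by (intro sum.cong refl arg_cong2[where f = scaleR] Hb)
    then show ?thesis
      by (simp add: sum_matrix_vector_mult scaleR_matrix_vector outer_mult_vec coeff mult_ac)
  qed
  then have H_eq: "H = (\<Sum>a\<in>B. (a \<bullet> (H *v a)) *\<^sub>R outer (G *v a) (G *v a))"
    unfolding matrix_eq by blast
  show ?thesis by (rule that[OF B(1) B(3) G_eq H_eq])
qed

lemma psd_matrix_decomposition:
  fixes M :: "real^'n^'n"
  assumes "transpose M = M" "\<And>x. x \<bullet> (M *v x) \<ge> 0"
  obtains B d where "finite B" "\<And>b. b \<in> B \<Longrightarrow> norm b = 1" "\<And>b. b \<in> B \<Longrightarrow> d b \<ge> 0"
    "M = (\<Sum>b\<in>B. d b *\<^sub>R outer b b)"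
proof (rule simultaneous_diagonalization[of "mat 1" M])
  fix B :: "(real^'n) set"
  assume B: "finite B" "\<And>a b. a \<in> B \<Longrightarrow> b \<in> B \<Longrightarrow> a \<bullet> (mat 1 *v b) = (if a = b then 1 else 0)"
    and B3: "M = (\<Sum>a\<in>B. (a \<bullet> (M *v a)) *\<^sub>R outer (mat 1 *v a) (mat 1 *v a))"
  show thesis
  proof (rule that[OF B(1)])
    show "norm b = 1" if "b \<in> B" for b using B(2)[OF that that] by (simp add: norm_eq_1)
    show "M = (\<Sum>a\<in>B. (a \<bullet> (M *v a)) *\<^sub>R outer a a)"
      using B3 unfolding matrix_vector_mul_lid .
    show "b \<bullet> (M *v b) \<ge> 0" for b by (rule assms(2))
  qed
qed (use assms(1) in auto)

lemma psd_inner_psd: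
  fixes M N :: "real^'n^'n"
  assumes "transpose M = M" "\<And>x. x \<bullet> (M *v x) \<ge> 0" "\<And>x. x \<bullet> (N *v x) \<ge> 0"
  shows "M \<bullet> N \<ge> 0"
proof -
  obtain B d where B: "finite B" "\<And>b. b \<in> B \<Longrightarrow> norm b = 1" "\<And>b. b \<in> B \<Longrightarrow> d b \<ge> 0"
    and M: "M = (\<Sum>b\<in>B. d b *\<^sub>R outer b b)"
    using psd_matrix_decomposition[OF assms(1,2)] by blast
  have "M \<bullet> N = (\<Sum>b\<in>B. d b * (b \<bullet> (N *v b)))"
    by (subst M) (simp add: inner_sum_left outer_inner)
  also have "\<dots> \<ge> 0" using B(3) assms(3) by (intro sum_nonneg) auto
  finally show ?thesis .
qed

lemma psd_trace_nonneg:
  fixes M :: "real^'n^'n"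
  assumes "transpose M = M" "\<And>x. x \<bullet> (M *v x) \<ge> 0"
  shows "mat 1 \<bullet> M \<ge> 0"
  using psd_inner_psd[OF assms, of "mat 1"] by (simp add: inner_commute)

lemma psd_trace_zero:
  fixes M :: "real^'n^'n"
  assumes "transpose M = M" "\<And>x. x \<bullet> (M *v x) \<ge> 0" "mat 1 \<bullet> M = 0"
  shows "M = 0"
proof -
  obtain B d where B: "finite B" "\<And>b. b \<in> B \<Longrightarrow> norm b = 1" "\<And>b. b \<in> B \<Longrightarrow> d b \<ge> 0"
     and M: "M = (\<Sum>b\<in>B. d b *\<^sub>R outer b b)"
    using psd_matrix_decomposition[OF assms(1,2)] by blast
  have "mat 1 \<bullet> M = (\<Sum>b\<in>B. d b * (b \<bullet> b))"
    by (subst M) (simp add: inner_sum_right inner_outer)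
  also have "\<dots> = (\<Sum>b\<in>B. d b)" using B by (intro sum.cong) (auto simp: norm_eq_1)
  finally have "\<forall>b\<in>B. d b = 0" using assms(3) B by (simp add: sum_nonneg_eq_0_iff)
  then show ?thesis by (subst M) simp
qed

section \<open>Nonnegative quadratic forms with quadratic coefficients in two variables\<close>

text \<open>The triple \<open>(G, H, K)\<close> represents a linear functional on the forms
  \<open>s\<^sup>2 A + s t B + t\<^sup>2 C\<close>, and the second hypothesis says that it is positive on squares. With
  \<open>u\<^sub>a = G *v a\<close> diagonalizing, \<open>G = \<Sum> u\<^sub>a u\<^sub>a\<^sup>T\<close> and \<open>H = \<Sum> d\<^sub>a u\<^sub>a u\<^sub>a\<^sup>T\<close>. Put
  \<open>D = \<Sum> d\<^sub>a\<^sup>2 u\<^sub>a u\<^sub>a\<^sup>T\<close>. Then \<open>(G, H, D)\<close> is the sum of the evaluations at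
  \<open>s = 1, t = d\<^sub>a, y = u\<^sub>a\<close>, and the remainder \<open>K - D\<close>, which pairs with \<open>C\<close> only, is a Schur
  complement and hence positive semidefinite.\<close>

lemma positive_functional_nonneg:
  fixes A B C G H K :: "real^'n^'n"
  assumes sym: "transpose G = G" "transpose H = H" "transpose K = K"
    and pos: "\<And>x y. (x, y) \<noteq> 0 \<Longrightarrow> x \<bullet> (G *v x) + 2 * (x \<bullet> (H *v y)) + y \<bullet> (K *v y) > 0"
    and psd: "\<And>s t y. s\<^sup>2 * (y \<bullet> (A *v y)) + s * t * (y \<bullet> (B *v y)) + t\<^sup>2 * (y \<bullet> (C *v y)) \<ge> 0"
  shows "G \<bullet> A + H \<bullet> B + K \<bullet> C \<ge> 0"
proof -
  have "x \<bullet> (G *v x) > 0" if "x \<noteq> 0" for x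
    using pos[of x 0] that by (simp add: zero_prod_def)
  then obtain E where E: "finite E"
    "\<And>a b. a \<in> E \<Longrightarrow> b \<in> E \<Longrightarrow> a \<bullet> (G *v b) = (if a = b then 1 else 0)"
    and G_eq: "G = (\<Sum>a\<in>E. outer (G *v a) (G *v a))"
    and H_eq: "H = (\<Sum>a\<in>E. (a \<bullet> (H *v a)) *\<^sub>R outer (G *v a) (G *v a))"
    using simultaneous_diagonalization[OF sym(1) _ sym(2)] by blast
  define d where "d a = a \<bullet> (H *v a)" for a
  define D where "D = (\<Sum>a\<in>E. (d a)\<^sup>2 *\<^sub>R outer (G *v a) (G *v a))"
  have G_vec: "G *v x = (\<Sum>a\<in>E. ((G *v a) \<bullet> x) *\<^sub>R (G *v a))" for x
    by (subst (1) G_eq) (simp add: sum_matrix_vector_mult outer_mult_vec)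
  have H_vec: "H *v x = (\<Sum>a\<in>E. (d a * ((G *v a) \<bullet> x)) *\<^sub>R (G *v a))" for x
    by (subst (1) H_eq)
      (simp add: sum_matrix_vector_mult scaleR_matrix_vector outer_mult_vec d_def)
  have D_vec: "D *v x = (\<Sum>a\<in>E. ((d a)\<^sup>2 * ((G *v a) \<bullet> x)) *\<^sub>R (G *v a))" for x
    by (simp add: D_def sum_matrix_vector_mult scaleR_matrix_vector outer_mult_vec)
  have K'_psd: "y \<bullet> ((K - D) *v y) \<ge> 0" for y
  proof (cases "y = 0")
    case False
    \<comment> \<open>This is \<open>x = - G\<^sup>-\<^sup>1 H y\<close>, the minimizer of the positive functional for the given \<open>y\<close>.\<close>
    define x where "x = - (\<Sum>a\<in>E. (d a * ((G *v a) \<bullet> y)) *\<^sub>R a)"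
    have "G *v x = - (\<Sum>a\<in>E. (d a * ((G *v a) \<bullet> y)) *\<^sub>R (G *v a))"
      by (simp add: x_def matrix_vector_mult_scaleR linear_neg[OF matrix_vector_mul_linear] linear_sum[OF matrix_vector_mul_linear])
    then have Gx: "G *v x = - (H *v y)" by (simp add: H_vec)
    have "a \<bullet> (H *v y) = d a * ((G *v a) \<bullet> y)" if "a \<in> E" for a
    proof -
      have "a \<bullet> (H *v y) = (\<Sum>b\<in>E. if b = a then d a * ((G *v a) \<bullet> y) else 0)"
        unfolding H_vec inner_sum_right by (intro sum.cong) (auto simp: E(2) that)
      then show ?thesis using E(1) that by simp
    qed
    then have "x \<bullet> (H *v y) = - (\<Sum>a\<in>E. (d a)\<^sup>2 * ((G *v a) \<bullet> y)\<^sup>2)"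
      by (simp add: x_def inner_sum_left power2_eq_square mult_ac)
    moreover have "y \<bullet> (D *v y) = (\<Sum>a\<in>E. (d a)\<^sup>2 * ((G *v a) \<bullet> y)\<^sup>2)"
      by (simp add: D_vec inner_sum_right power2_eq_square mult_ac inner_commute)
    ultimately have "x \<bullet> (H *v y) = - (y \<bullet> (D *v y))" by simp
    moreover have "x \<bullet> (G *v x) + 2 * (x \<bullet> (H *v y)) + y \<bullet> (K *v y) > 0"
      using False by (intro pos) (simp add: zero_prod_def)
    ultimately show ?thesis
      by (simp add: Gx matrix_vector_mult_diff_rdistrib inner_diff_right)
  qed simp
  have "transpose D = D"
    by (simp add: D_def transpose_def outer_def vec_eq_iff mult_ac)
  then have "transpose (K - D) = K - D"
    using sym(3) by (simp add: transpose_def vec_eq_iff)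
  then have K'C: "(K - D) \<bullet> C \<ge> 0"
    using K'_psd psd[of 0 _ 1] by (intro psd_inner_psd) auto
  define q where "q a M = (G *v a) \<bullet> (M *v (G *v a))" for a M
  have "G \<bullet> A = (\<Sum>a\<in>E. q a A)"
    by (subst G_eq) (simp add: q_def inner_sum_left outer_inner)
  moreover have "H \<bullet> B = (\<Sum>a\<in>E. d a * q a B)"
    by (subst H_eq) (simp add: q_def d_def inner_sum_left outer_inner)
  moreover have "D \<bullet> C = (\<Sum>a\<in>E. (d a)\<^sup>2 * q a C)"
    by (simp add: D_def q_def inner_sum_left outer_inner)
  ultimately have "G \<bullet> A + H \<bullet> B + K \<bullet> C = (\<Sum>a\<in>E. q a A + d a * q a B + (d a)\<^sup>2 * q a C) + (K - D) \<bullet> C"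
    by (simp add: inner_diff_left sum.distrib)
  moreover have "(\<Sum>a\<in>E. q a A + d a * q a B + (d a)\<^sup>2 * q a C) \<ge> 0"
    using psd[of 1 _ "d _"] by (intro sum_nonneg) (simp add: q_def)
  ultimately show ?thesis using K'C by linarith
qed

text \<open>The coefficients of \<open>s\<^sup>2\<close>, \<open>s t\<close> and \<open>t\<^sup>2\<close> in the square \<open>(s (a \<bullet> y) + t (b \<bullet> y))\<^sup>2\<close>, as
  matrices in \<open>y\<close>.\<close>

definition gram :: "(real^'n) \<times> (real^'n) \<Rightarrow> (real^'n^'n) \<times> (real^'n^'n) \<times> (real^'n^'n)" where
  "gram = (\<lambda>(a, b). (outer a a, outer a b + outer b a, outer b b))"

lemma continuous_on_gram: "continuous_on S gram"
  unfolding gram_def outer_def case_prod_beta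
  by (intro continuous_intros)

lemma inner_add_transpose:
  fixes Z M :: "real^'n^'n"
  assumes "transpose M = M"
  shows "(Z + transpose Z) \<bullet> M = 2 * (Z \<bullet> M)"
  using inner_transpose[of Z M] assms by (simp add: inner_add_left)

lemma add_transpose_symmetric: "transpose (Z + transpose Z) = Z + transpose (Z :: real^'n^'n)"
  by (simp add: transpose_def vec_eq_iff)

text \<open>Normalizing the trace replaces the cone of sums of squares by the convex hull of a compact
  set, which is closed, so that a point outside it can be strictly separated.\<close>

lemma psd_mem_convex_hull_gram:
  fixes A B C :: "real^'n^'n"
  assumes sym: "transpose A = A" "transpose B = B" "transpose C = C"
    and psd: "\<And>s t y. s\<^sup>2 * (y \<bullet> (A *v y)) + s * t * (y \<bullet> (B *v y)) + t\<^sup>2 * (y \<bullet> (C *v y)) \<ge> 0"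
    and trace: "mat 1 \<bullet> A + mat 1 \<bullet> C = 1"
  shows "(A, B, C) \<in> convex hull (gram ` sphere 0 1)"
proof (rule ccontr)
  assume "(A, B, C) \<notin> convex hull (gram ` sphere 0 1)"
  moreover have "closed (convex hull (gram ` sphere (0 :: (real^'n) \<times> (real^'n)) 1))"
    by (intro compact_imp_closed compact_convex_hull compact_continuous_image
        continuous_on_gram compact_sphere)
  ultimately obtain Z \<beta> where sep: "Z \<bullet> (A, B, C) < \<beta>"
    "\<And>x. x \<in> convex hull (gram ` sphere (0 :: (real^'n) \<times> (real^'n)) 1) \<Longrightarrow> Z \<bullet> x > \<beta>"
    using separating_hyperplane_closed_point[OF convex_convex_hull] by meson
  obtain Z1 Z2 Z3 where Z: "Z = (Z1, Z2, Z3)" by (cases Z)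
  \<comment> \<open>The trace is \<open>1\<close> on the hull and on the given point, so subtracting \<open>\<beta>\<close> times the trace makes
    the separating constant zero; a functional that is positive on unit squares is then positive on
    all nonzero squares.\<close>
  define Y1 where "Y1 = Z1 - \<beta> *\<^sub>R mat 1"
  define Y3 where "Y3 = Z3 - \<beta> *\<^sub>R mat 1"
  define G where "G = Y1 + transpose Y1"
  define H where "H = Z2 + transpose Z2"
  define K where "K = Y3 + transpose Y3"
  have quad: "x \<bullet> (G *v x) + 2 * (x \<bullet> (H *v y)) + y \<bullet> (K *v y) =
      2 * (Z \<bullet> gram (x, y) - \<beta> * (norm (x, y))\<^sup>2)" for x y
  proof -
    have "x \<bullet> (G *v x) = 2 * (Y1 \<bullet> outer x x)" "y \<bullet> (K *v y) = 2 * (Y3 \<bullet> outer y y)"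
      by (simp_all add: G_def K_def flip: inner_outer, simp_all add: inner_add_transpose transpose_outer)
    moreover have "2 * (x \<bullet> (H *v y)) = H \<bullet> (outer x y + outer y x)"
      using inner_symmetric_matrix[of H x y] add_transpose_symmetric[of Z2]
      by (simp add: inner_add_right inner_outer H_def)
    moreover have "\<dots> = 2 * (Z2 \<bullet> (outer x y + outer y x))"
      unfolding H_def 
      by (intro inner_add_transpose) (simp add: outer_def transpose_def vec_eq_iff add.commute mult.commute)
    ultimately show ?thesis
      by (simp add: Z gram_def Y1_def Y3_def inner_diff_left inner_outer norm_prod_def
          power2_norm_eq_inner scaleR_matrix_vector algebra_simps)
  qed
  have "x \<bullet> (G *v x) + 2 * (x \<bullet> (H *v y)) + y \<bullet> (K *v y) > 0" if "(x, y) \<noteq> 0" for x y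
  proof -
    define r where "r = norm (x, y)"
    have r: "r > 0" using that by (simp add: r_def)
    define x' where "x' = x /\<^sub>R r"
    define y' where "y' = y /\<^sub>R r"
    have xy: "x = r *\<^sub>R x'" "y = r *\<^sub>R y'" using r by (auto simp: x'_def y'_def)
    have "(x', y') = (x, y) /\<^sub>R r" by (simp add: x'_def y'_def)
    then have n: "norm (x', y') = 1" using r by (simp add: r_def del: scaleR_Pair)
    then have "gram (x', y') \<in> convex hull (gram ` sphere 0 1)"
      by (intro hull_inc imageI) simp
    from sep(2)[OF this] have "x' \<bullet> (G *v x') + 2 * (x' \<bullet> (H *v y')) + y' \<bullet> (K *v y') > 0"
      unfolding quad by (simp add: n)
    then have "r\<^sup>2 * (x' \<bullet> (G *v x') + 2 * (x' \<bullet> (H *v y')) + y' \<bullet> (K *v y')) > 0"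
      using r by simp
    then show ?thesis
      unfolding xy by (simp add: matrix_vector_mult_scaleR power2_eq_square algebra_simps)
  qed
  then have "G \<bullet> A + H \<bullet> B + K \<bullet> C \<ge> 0"
    using psd by (intro positive_functional_nonneg) (auto simp: G_def H_def K_def add_transpose_symmetric)
  moreover have "G \<bullet> A + H \<bullet> B + K \<bullet> C = 2 * (Z \<bullet> (A, B, C) - \<beta> * (mat 1 \<bullet> A + mat 1 \<bullet> C))"
    unfolding G_def H_def K_def inner_add_transpose[OF sym(1)] inner_add_transpose[OF sym(2)]
      inner_add_transpose[OF sym(3)]
    by (simp add: Z Y1_def Y3_def inner_diff_left algebra_simps)
  ultimately show False using sep(1) trace by simp
qed

text \<open>Divide by the trace. If the trace is zero, all three matrices vanish.\<close>

lemma psd_cone_gram: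
  fixes A B C :: "real^'n^'n"
  assumes sym: "transpose A = A" "transpose B = B" "transpose C = C"
    and psd: "\<And>s t y. s\<^sup>2 * (y \<bullet> (A *v y)) + s * t * (y \<bullet> (B *v y)) + t\<^sup>2 * (y \<bullet> (C *v y)) \<ge> 0"
  obtains S u where "finite S" "\<And>z. z \<in> S \<Longrightarrow> u z \<ge> 0" "(A, B, C) = (\<Sum>z\<in>S. u z *\<^sub>R gram z)"
proof -
  define \<tau> where "\<tau> = mat 1 \<bullet> A + mat 1 \<bullet> C"
  have A: "x \<bullet> (A *v x) \<ge> 0" and C: "x \<bullet> (C *v x) \<ge> 0" for x
    using psd[of 1 x 0] psd[of 0 x 1] by auto
  have trA: "mat 1 \<bullet> A \<ge> 0" and trC: "mat 1 \<bullet> C \<ge> 0"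
    using A C sym by (auto intro: psd_trace_nonneg)
  show thesis
  proof (cases "\<tau> = 0")
    case True
    then have AC: "A = 0" "C = 0"
      using psd_trace_zero[OF sym(1) A] psd_trace_zero[OF sym(3) C] trA trC
      unfolding \<tau>_def by linarith+
    \<comment> \<open>With \<open>A = C = 0\<close> the form is \<open>s t B\<close>, which can be nonnegative for both signs of \<open>s t\<close> only if
      \<open>B = 0\<close>.\<close>
    have "y \<bullet> (B *v y) \<ge> 0" "y \<bullet> ((- B) *v y) \<ge> 0" for y
      using psd[of 1 y 1] psd[of 1 y "-1"] 
      by (simp_all add: AC scaleR_matrix_vector[of "-1", simplified])
    moreover have "transpose (- B) = - B"
      using sym(2) by (simp add: transpose_def vec_eq_iff)
    ultimately have "mat 1 \<bullet> B \<ge> 0" "mat 1 \<bullet> (- B) \<ge> 0"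
      using sym(2) by (blast intro: psd_trace_nonneg)+
    then have "B = 0"
      using psd_trace_zero[OF sym(2)] \<open>\<And>y. y \<bullet> (B *v y) \<ge> 0\<close> by simp
    with AC show thesis by (intro that[of "{}"]) (auto simp: zero_prod_def)
  next
    case False
    then have \<tau>: "\<tau> > 0" using trA trC by (simp add: \<tau>_def)
    have "(A /\<^sub>R \<tau>, B /\<^sub>R \<tau>, C /\<^sub>R \<tau>) \<in> convex hull (gram ` sphere 0 1)"
    proof (rule psd_mem_convex_hull_gram)
      show "transpose (A /\<^sub>R \<tau>) = A /\<^sub>R \<tau>" "transpose (B /\<^sub>R \<tau>) = B /\<^sub>R \<tau>"
        "transpose (C /\<^sub>R \<tau>) = C /\<^sub>R \<tau>"
        using sym by (simp_all add: transpose_def vec_eq_iff)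
      show "mat 1 \<bullet> (A /\<^sub>R \<tau>) + mat 1 \<bullet> (C /\<^sub>R \<tau>) = 1"
        using False by (simp add: distrib_left[symmetric] flip: \<tau>_def)
      show "s\<^sup>2 * (y \<bullet> ((A /\<^sub>R \<tau>) *v y)) + s * t * (y \<bullet> ((B /\<^sub>R \<tau>) *v y)) +
          t\<^sup>2 * (y \<bullet> ((C /\<^sub>R \<tau>) *v y)) \<ge> 0" for s t y
      proof -
        have "0 \<le> (s\<^sup>2 * (y \<bullet> (A *v y)) + s * t * (y \<bullet> (B *v y)) + t\<^sup>2 * (y \<bullet> (C *v y))) / \<tau>"
          using psd[of s y t] \<tau> by simp
        then show ?thesis
          using \<tau> by (simp add: scaleR_matrix_vector field_simps)
      qed
    qed
    then obtain S u where S: "finite S" "S \<subseteq> gram ` sphere 0 1" "\<forall>x\<in>S. 0 \<le> u x"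
      "(\<Sum>v\<in>S. u v *\<^sub>R v) = (A /\<^sub>R \<tau>, B /\<^sub>R \<tau>, C /\<^sub>R \<tau>)"
      unfolding convex_hull_explicit by blast
    from S(1,2) obtain T where T: "finite T" "inj_on gram T" "S = gram ` T"
      by (metis finite_image_iff subset_image_inj)
    have "(A, B, C) = \<tau> *\<^sub>R (\<Sum>v\<in>S. u v *\<^sub>R v)"
      using \<tau> by (simp add: S(4))
    also have "\<dots> = (\<Sum>z\<in>T. (\<tau> * u (gram z)) *\<^sub>R gram z)"
      using T by (simp add: sum.reindex scaleR_sum_right)
    finally show thesis
      using T S(3) \<tau> by (intro that[of T "\<lambda>z. \<tau> * u (gram z)"]) auto
  qed
qed

definition quadratic_form :: "(real^'n \<Rightarrow> real) \<Rightarrow> bool" where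
  "quadratic_form q \<longleftrightarrow> (\<exists>M. q = (\<lambda>x. x \<bullet> (M *v x)))"

lemma quadratic_form_symmetric_matrix:
  assumes "quadratic_form q"
  obtains M where "transpose M = M" "\<And>x. q x = x \<bullet> (M *v x)"
proof -
  obtain N where N: "\<And>x. q x = x \<bullet> (N *v x)"
    using assms by (auto simp: quadratic_form_def)
  define M where "M = (1/2) *\<^sub>R (N + transpose N)"
  have "x \<bullet> (transpose N *v x) = x \<bullet> (N *v x)" for x
    by (metis dot_lmul_matrix inner_commute transpose_matrix_vector)
  then have "q x = x \<bullet> (M *v x)" for x
    by (simp add: M_def N scaleR_matrix_vector matrix_vector_mult_add_rdistrib inner_add_right)
  moreover have "transpose M = M"
    by (simp add: M_def transpose_def vec_eq_iff)
  ultimately show ?thesis using that by blast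
qed

lemma quadratic_form_mult:
  "quadratic_form (\<lambda>x. (a \<bullet> x) * (b \<bullet> x))"
  unfolding quadratic_form_def
  by (rule exI[of _ "outer a b"]) (simp add: outer_mult_vec inner_commute mult_ac)

lemma quadratic_form_zero: "quadratic_form (\<lambda>x. 0)"
  unfolding quadratic_form_def by (rule exI[of _ 0]) simp

lemma quadratic_form_add:
  "quadratic_form p \<Longrightarrow> quadratic_form q \<Longrightarrow> quadratic_form (\<lambda>x. p x + q x)"
  unfolding quadratic_form_def
proof (elim exE)
  fix M N assume "p = (\<lambda>x. x \<bullet> (M *v x))" "q = (\<lambda>x. x \<bullet> (N *v x))"
  then show "\<exists>M. (\<lambda>x. p x + q x) = (\<lambda>x. x \<bullet> (M *v x))"
    by (intro exI[of _ "M + N"]) (simp add: matrix_vector_mult_add_rdistrib inner_add_right)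
qed

lemma quadratic_form_component_mult: "quadratic_form (\<lambda>x. c * (x $ i * x $ j))"
  using quadratic_form_mult[of "c *\<^sub>R axis i 1" "axis j 1"]
  by (simp add: inner_axis' mult_ac)

lemma quadratic_form_3_coefficients:
  fixes q :: "real^3 \<Rightarrow> real"
  assumes "quadratic_form q"
  obtains a b c d e f where "\<And>w. q w = a * (w$1 * w$1) + b * (w$2 * w$2) + c * (w$3 * w$3)
    + d * (w$1 * w$2) + e * (w$1 * w$3) + f * (w$2 * w$3)"
proof -
  obtain M where M: "q = (\<lambda>x. x \<bullet> (M *v x))"
    using assms by (auto simp: quadratic_form_def)
  show ?thesis
    by (rule that[of "M$1$1" "M$2$2" "M$3$3" "M$1$2 + M$2$1" "M$1$3 + M$3$1" "M$2$3 + M$3$2"])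
      (simp add: M inner_vec_def matrix_vector_mult_def sum_3 algebra_simps)
qed

text \<open>Calderon's theorem on biquadratic forms in \<open>2 \<times> n\<close> variables. The weights of the convex
  combination are absorbed into the vectors by taking square roots.\<close>

theorem psd_pencil_sum_of_squares:
  fixes A B C :: "real^'n \<Rightarrow> real"
  assumes forms: "quadratic_form A" "quadratic_form B" "quadratic_form C"
    and psd: "\<And>s t y. s\<^sup>2 * A y + s * t * B y + t\<^sup>2 * C y \<ge> 0"
  shows "\<exists>zs. \<forall>s t y. s\<^sup>2 * A y + s * t * B y + t\<^sup>2 * C y =
    (\<Sum>(a, b)\<leftarrow>zs. (s * (a \<bullet> y) + t * (b \<bullet> y))\<^sup>2)"
proof -
  obtain MA where MA: "transpose MA = MA" "\<And>y. A y = y \<bullet> (MA *v y)"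
    using quadratic_form_symmetric_matrix[OF forms(1)] by blast
  obtain MB where MB: "transpose MB = MB" "\<And>y. B y = y \<bullet> (MB *v y)"
    using quadratic_form_symmetric_matrix[OF forms(2)] by blast
  obtain MC where MC: "transpose MC = MC" "\<And>y. C y = y \<bullet> (MC *v y)"
    using quadratic_form_symmetric_matrix[OF forms(3)] by blast
  obtain S u where S: "finite S" "\<And>z. z \<in> S \<Longrightarrow> u z \<ge> 0"
    and eq: "(MA, MB, MC) = (\<Sum>z\<in>S. u z *\<^sub>R gram z)"
    using psd_cone_gram[OF MA(1) MB(1) MC(1)] psd unfolding MA(2) MB(2) MC(2) by blast
  have "MA = (\<Sum>(a, b)\<in>S. u (a, b) *\<^sub>R outer a a)"
    using arg_cong[OF eq, of fst] by (simp add: fst_sum gram_def case_prod_beta)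
  then have A: "A y = (\<Sum>(a, b)\<in>S. u (a, b) * (a \<bullet> y)\<^sup>2)" for y
    by (simp add: MA(2) sum_matrix_vector_mult case_prod_beta scaleR_matrix_vector outer_mult_vec
        inner_sum_right inner_commute power2_eq_square mult_ac)
  have "MB = (\<Sum>(a, b)\<in>S. u (a, b) *\<^sub>R (outer a b + outer b a))"
    using arg_cong[OF eq, of "fst \<circ> snd"] by (simp add: fst_sum snd_sum gram_def case_prod_beta)
  then have B: "B y = (\<Sum>(a, b)\<in>S. u (a, b) * (2 * (a \<bullet> y) * (b \<bullet> y)))" for y
    by (simp add: MB(2) sum_matrix_vector_mult case_prod_beta scaleR_matrix_vector outer_mult_vec
        inner_sum_right inner_commute power2_eq_square matrix_vector_mult_add_rdistrib
        inner_add_right mult_ac)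
  have "MC = (\<Sum>(a, b)\<in>S. u (a, b) *\<^sub>R outer b b)"
    using arg_cong[OF eq, of "snd \<circ> snd"] by (simp add: snd_sum gram_def case_prod_beta)
  then have C: "C y = (\<Sum>(a, b)\<in>S. u (a, b) * (b \<bullet> y)\<^sup>2)" for y
    by (simp add: MC(2) sum_matrix_vector_mult case_prod_beta scaleR_matrix_vector outer_mult_vec
        inner_sum_right inner_commute power2_eq_square mult_ac)
  obtain zs where zs: "set zs = S" "distinct zs"
    using finite_distinct_list[OF S(1)] by blast
  define root where "root z = sqrt (u z) *\<^sub>R z" for z
  have "s\<^sup>2 * A y + s * t * B y + t\<^sup>2 * C y =
      (\<Sum>(a, b)\<leftarrow>map root zs. (s * (a \<bullet> y) + t * (b \<bullet> y))\<^sup>2)" for s t y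
  proof -
    have "s\<^sup>2 * A y + s * t * B y + t\<^sup>2 * C y =
        (\<Sum>(a, b)\<in>S. u (a, b) * (s * (a \<bullet> y) + t * (b \<bullet> y))\<^sup>2)"
      unfolding A B C
      by (simp add: sum_distrib_left case_prod_beta flip: sum.distrib)
        (intro sum.cong refl, simp add: power2_eq_square algebra_simps)
    also have "\<dots> = (\<Sum>z\<in>S. (s * (fst (root z) \<bullet> y) + t * (snd (root z) \<bullet> y))\<^sup>2)"
    proof (intro sum.cong refl, clarify)
      fix a b assume "(a, b) \<in> S"
      then have "u (a, b) \<ge> 0" by (rule S(2))
      moreover have "s * (fst (root (a, b)) \<bullet> y) + t * (snd (root (a, b)) \<bullet> y) =
          sqrt (u (a, b)) * (s * (a \<bullet> y) + t * (b \<bullet> y))"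
        by (simp add: root_def algebra_simps)
      ultimately show "u (a, b) * (s * (a \<bullet> y) + t * (b \<bullet> y))\<^sup>2 =
          (s * (fst (root (a, b)) \<bullet> y) + t * (snd (root (a, b)) \<bullet> y))\<^sup>2"
        by (simp add: power_mult_distrib)
    qed
    also have "\<dots> = (\<Sum>(a, b)\<leftarrow>map root zs. (s * (a \<bullet> y) + t * (b \<bullet> y))\<^sup>2)"
      using sum.distinct_set_conv_list[OF zs(2)] by (simp add: zs(1) o_def case_prod_beta)
    finally show ?thesis .
  qed
  then show ?thesis by blast
qed

section \<open>Biquadratic maps\<close>

text \<open>Every monomial \<open>x\<^sub>i x\<^sub>j y\<^sub>k y\<^sub>l\<close> is the product of \<open>x\<^sub>i y\<^sub>k\<close> and \<open>x\<^sub>j y\<^sub>l\<close>, so in finite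
  dimension the sums of products of two bilinear maps are exactly the biquadratic forms. This description
  is free of coordinates and so visibly stable under linear substitutions.\<close>

inductive biquadratic_map :: "('a::real_vector \<Rightarrow> 'b::real_vector \<Rightarrow> real) \<Rightarrow> bool" where
  zero: "biquadratic_map (\<lambda>v w. 0)"
| add_product: "bilinear \<beta> \<Longrightarrow> bilinear \<gamma> \<Longrightarrow> biquadratic_map F \<Longrightarrow>
    biquadratic_map (\<lambda>v w. \<beta> v w * \<gamma> v w + F v w)"

lemma biquadratic_map_swap: "biquadratic_map F \<Longrightarrow> biquadratic_map (\<lambda>v w. F w v)"
proof (induction rule: biquadratic_map.induct)
  case (add_product \<beta> \<gamma> F)
  then show ?case
    by (intro biquadratic_map.add_product[of "\<lambda>v w. \<beta> w v" "\<lambda>v w. \<gamma> w v"])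
      (auto simp: bilinear_def)
qed (rule biquadratic_map.zero)

lemma biquadratic_map_compose:
  "biquadratic_map F \<Longrightarrow> linear f \<Longrightarrow> linear g \<Longrightarrow> biquadratic_map (\<lambda>v w. F (f v) (g w))"
proof (induction rule: biquadratic_map.induct)
  case (add_product \<beta> \<gamma> F)
  then show ?case
    by (intro biquadratic_map.add_product[of "\<lambda>v w. \<beta> (f v) (g w)" "\<lambda>v w. \<gamma> (f v) (g w)"])
      (auto simp: bilinear_def intro: linear_compose[unfolded o_def])
qed (rule biquadratic_map.zero)

lemma biquadratic_map_add:
  "biquadratic_map F \<Longrightarrow> biquadratic_map G \<Longrightarrow> biquadratic_map (\<lambda>v w. F v w + G v w)"
proof (induction rule: biquadratic_map.induct)
  case (add_product \<beta> \<gamma> F)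
  then show ?case
    using biquadratic_map.add_product[of \<beta> \<gamma> "\<lambda>v w. F v w + G v w"] by (simp add: add.assoc)
qed simp

lemma bilinear_coordinates:
  fixes \<beta> :: "real^'m \<Rightarrow> real^'n \<Rightarrow> real"
  assumes "bilinear \<beta>"
  shows "\<beta> v w = (\<Sum>i\<in>UNIV. \<Sum>j\<in>UNIV. v $ i * w $ j * \<beta> (axis i 1) (axis j 1))"
proof -
  have "\<beta> v w = \<beta> (\<Sum>i\<in>UNIV. v $ i *\<^sub>R axis i 1) (\<Sum>j\<in>UNIV. w $ j *\<^sub>R axis j 1)"
    by (simp add: basis_expansion flip: scalar_mult_eq_scaleR)
  also have "\<dots> = (\<Sum>i\<in>UNIV. \<Sum>j\<in>UNIV. \<beta> (v $ i *\<^sub>R axis i 1) (w $ j *\<^sub>R axis j 1))"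
    by (simp add: bilinear_sum[OF assms] sum.cartesian_product)
  finally show ?thesis
    by (simp add: bilinear_lmul[OF assms] bilinear_rmul[OF assms] mult_ac)
qed

lemma bilinear_3_rows:
  fixes \<beta> :: "real^3 \<Rightarrow> real^'n \<Rightarrow> real"
  assumes "bilinear \<beta>"
  obtains a b c where "\<And>v w. \<beta> v w = v$1 * (a \<bullet> w) + v$2 * (b \<bullet> w) + v$3 * (c \<bullet> w)"
proof (rule that)
  define r where "r i = (\<chi> j. \<beta> (axis i 1) (axis j 1))" for i
  show "\<beta> v w = v$1 * (r 1 \<bullet> w) + v$2 * (r 2 \<bullet> w) + v$3 * (r 3 \<bullet> w)" for v w
    by (subst bilinear_coordinates[OF assms])
      (simp add: r_def inner_vec_def sum_3 sum_distrib_left mult_ac)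
qed

lemma biquadratic_map_coefficients:
  fixes F :: "real^3 \<Rightarrow> real^'n \<Rightarrow> real"
  assumes "biquadratic_map F"
  shows "\<exists>P S2 S3 A B C. quadratic_form P \<and> quadratic_form S2 \<and> quadratic_form S3 \<and>
    quadratic_form A \<and> quadratic_form B \<and> quadratic_form C \<and>
    (\<forall>v w. F v w = v$1 * v$1 * P w + v$1 * v$2 * S2 w + v$1 * v$3 * S3 w +
      ((v$2)\<^sup>2 * A w + v$2 * v$3 * B w + (v$3)\<^sup>2 * C w))"
  using assms
proof (induction rule: biquadratic_map.induct)
  case zero
  show ?case using quadratic_form_zero by fastforce
next
  case (add_product \<beta> \<gamma> F)
  from add_product.IH obtain P S2 S3 A B C where IH: "quadratic_form P" "quadratic_form S2"
    "quadratic_form S3" "quadratic_form A" "quadratic_form B" "quadratic_form C"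
    "\<And>v w. F v w = v$1 * v$1 * P w + v$1 * v$2 * S2 w + v$1 * v$3 * S3 w +
      ((v$2)\<^sup>2 * A w + v$2 * v$3 * B w + (v$3)\<^sup>2 * C w)" by blast
  obtain a b c where \<beta>: "\<And>v w. \<beta> v w = v$1 * (a \<bullet> w) + v$2 * (b \<bullet> w) + v$3 * (c \<bullet> w)"
    using bilinear_3_rows[OF add_product.hyps(1)] by blast
  obtain a' b' c' where \<gamma>: "\<And>v w. \<gamma> v w = v$1 * (a' \<bullet> w) + v$2 * (b' \<bullet> w) + v$3 * (c' \<bullet> w)"
    using bilinear_3_rows[OF add_product.hyps(2)] by blast
  show ?case
    by (rule exI[of _ "\<lambda>w. (a \<bullet> w) * (a' \<bullet> w) + P w"],
        rule exI[of _ "\<lambda>w. (a \<bullet> w) * (b' \<bullet> w) + (b \<bullet> w) * (a' \<bullet> w) + S2 w"],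
        rule exI[of _ "\<lambda>w. (a \<bullet> w) * (c' \<bullet> w) + (c \<bullet> w) * (a' \<bullet> w) + S3 w"],
        rule exI[of _ "\<lambda>w. (b \<bullet> w) * (b' \<bullet> w) + A w"],
        rule exI[of _ "\<lambda>w. (b \<bullet> w) * (c' \<bullet> w) + (c \<bullet> w) * (b' \<bullet> w) + B w"],
        rule exI[of _ "\<lambda>w. (c \<bullet> w) * (c' \<bullet> w) + C w"])
      (intro conjI quadratic_form_add quadratic_form_mult IH,
        simp add: \<beta> \<gamma> IH(7) power2_eq_square algebra_simps)
qed

text \<open>On the plane spanned by its zeros \<open>w1\<close> and \<open>w2\<close> the quadratic form \<open>F v0\<close> takes the value
  \<open>a b m\<close> at \<open>a w1 + b w2\<close>, and nonnegativity for both signs of \<open>a b\<close> forces \<open>m = 0\<close>.\<close>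

lemma biquadratic_map_zero_on_plane:
  fixes F :: "real^3 \<Rightarrow> real^3 \<Rightarrow> real"
  assumes F: "biquadratic_map F" and nonneg: "\<And>v w. v \<bullet> w = 0 \<Longrightarrow> F v w \<ge> 0"
    and v0: "v0 \<noteq> 0" and indep: "w1 \<noteq> w2" "independent {w1, w2}"
    and orth: "orthogonal w1 v0" "orthogonal w2 v0" and zeros: "F v0 w1 = 0" "F v0 w2 = 0"
    and w: "v0 \<bullet> w = 0"
  shows "F v0 w = 0"
proof -
  have "\<exists>m. \<forall>a b. F v0 (a *\<^sub>R w1 + b *\<^sub>R w2) = a\<^sup>2 * F v0 w1 + a * b * m + b\<^sup>2 * F v0 w2"
    using F
  proof (induction rule: biquadratic_map.induct)
    case zero
    show ?case by (intro exI[of _ 0]) simp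
  next
    case (add_product \<beta> \<gamma> F)
    then obtain m where "\<And>a b. F v0 (a *\<^sub>R w1 + b *\<^sub>R w2) = a\<^sup>2 * F v0 w1 + a * b * m + b\<^sup>2 * F v0 w2"
      by blast
    with add_product.hyps show ?case
      by (intro exI[of _ "\<beta> v0 w1 * \<gamma> v0 w2 + \<beta> v0 w2 * \<gamma> v0 w1 + m"])
        (simp add: bilinear_radd bilinear_rmul power2_eq_square algebra_simps)
  qed
  then obtain m where m: "\<And>a b. F v0 (a *\<^sub>R w1 + b *\<^sub>R w2) = a * b * m"
    using zeros by auto
  have "v0 \<bullet> (a *\<^sub>R w1 + b *\<^sub>R w2) = 0" for a b
    using orth by (simp add: orthogonal_def inner_add_right inner_commute)
  from nonneg[OF this, of 1 1] nonneg[OF this, of 1 "-1"] have "m = 0"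
    unfolding m by simp
  have "{x. v0 \<bullet> x = 0} \<subseteq> span {w1, w2}"
  proof (rule card_ge_dim_independent)
    show "dim {x. v0 \<bullet> x = 0} \<le> card {w1, w2}"
      using dim_hyperplane[OF v0] indep(1) by simp
  qed (use orth indep in \<open>auto simp: orthogonal_def inner_commute\<close>)
  with w have "w \<in> span {w1, w2}" by blast
  then obtain a where "w - a *\<^sub>R w1 \<in> span {w2}"
    using span_breakdown[of w1 "{w1, w2}" w] indep(1) by (auto simp: insert_Diff_if)
  then obtain b where "w - a *\<^sub>R w1 = b *\<^sub>R w2"
    unfolding span_singleton by blast
  then have "w = a *\<^sub>R w1 + b *\<^sub>R w2" by (simp add: algebra_simps)
  then show ?thesis using m \<open>m = 0\<close> by simp
qed

section \<open>Sums of squares modulo the pairing\<close>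

lemma nonneg_removable:
  fixes f :: "real \<Rightarrow> real"
  assumes "isCont f 0" "\<And>r. r \<noteq> 0 \<Longrightarrow> f r \<ge> 0"
  shows "f 0 \<ge> 0"
proof (rule tendsto_lowerbound)
  show "(f \<longlongrightarrow> f 0) (at 0)" using assms(1) by (simp add: isCont_def)
  show "\<forall>\<^sub>F r in at 0. 0 \<le> f r" using assms(2) by (auto simp: eventually_at_filter)
qed simp

lemma linear_coefficient_zero:
  fixes f :: "real \<Rightarrow> real"
  assumes "isCont f 0" "\<And>r. c * r + r\<^sup>2 * f r \<ge> 0"
  shows "c = 0"
proof -
  have "((\<lambda>r. c * r + r\<^sup>2 * f r) has_real_derivative c) (at 0)"
  proof -
    have "((\<lambda>r. c + r * f r) \<longlongrightarrow> c + 0 * f 0) (at 0)"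
      using assms(1) by (intro tendsto_intros) (simp add: isCont_def)
    moreover have "\<forall>\<^sub>F r in at 0. c + r * f r = (c * r + r\<^sup>2 * f r) / r"
      by (auto simp: eventually_at_filter power2_eq_square field_simps)
    ultimately have "((\<lambda>r. (c * r + r\<^sup>2 * f r) / r) \<longlongrightarrow> c) (at 0)"
      using Lim_transform_eventually by fastforce
    then show ?thesis by (simp add: has_field_derivative_iff)
  qed
  then show ?thesis
    by (rule DERIV_local_min[of _ _ _ 1]) (use assms(2) in auto)
qed

text \<open>The core of the argument: substituting \<open>v \<bullet> w - (v\<^sub>2 w\<^sub>2 + v\<^sub>3 w\<^sub>3)\<close> for \<open>v\<^sub>1 w\<^sub>1\<close> eliminates
  \<open>v\<^sub>1\<close> from \<open>F\<close> except for a multiple of \<open>v \<bullet> w\<close> and one linear term \<open>v\<^sub>1 T\<close>, which vanishes because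
  \<open>F\<close> is nonnegative. What is left is a nonnegative form in \<open>v\<^sub>2, v\<^sub>3\<close> and \<open>w\<close>.\<close>

lemma sos_modulo_pairing_axis:
  fixes F :: "real^3 \<Rightarrow> real^3 \<Rightarrow> real"
  assumes F: "biquadratic_map F"
    and nonneg: "\<And>v w. v \<bullet> w = 0 \<Longrightarrow> F v w \<ge> 0"
    and zero: "\<And>w. w $ 1 = 0 \<Longrightarrow> F (axis 1 1) w = 0"
  shows "\<exists>\<beta>s h. (\<forall>\<beta>\<in>set \<beta>s. bilinear \<beta>) \<and> bilinear h \<and>
    (\<forall>v w. F v w = (\<Sum>\<beta>\<leftarrow>\<beta>s. (\<beta> v w)\<^sup>2) + (v \<bullet> w) * h v w)"
proof -
  obtain P S2 S3 A B C where forms: "quadratic_form P" "quadratic_form S2" "quadratic_form S3"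
      "quadratic_form A" "quadratic_form B" "quadratic_form C"
    and F_eq: "\<And>v w. F v w = v$1 * v$1 * P w + v$1 * v$2 * S2 w + v$1 * v$3 * S3 w +
      ((v$2)\<^sup>2 * A w + v$2 * v$3 * B w + (v$3)\<^sup>2 * C w)"
    using biquadratic_map_coefficients[OF F] by blast
  obtain a b c d e f where P0: "\<And>w. P w = a * (w$1 * w$1) + b * (w$2 * w$2) + c * (w$3 * w$3)
    + d * (w$1 * w$2) + e * (w$1 * w$3) + f * (w$2 * w$3)"
    using quadratic_form_3_coefficients[OF forms(1)] by blast
  have P_zero: "P w = 0" if "w $ 1 = 0" for w
    using zero[OF that] by (simp add: F_eq axis_def)
  have "b = 0" "c = 0"
    using P_zero[of "vector [0, 1, 0]"] P_zero[of "vector [0, 0, 1]"] by (simp_all add: P0)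
  moreover from this have "f = 0"
    using P_zero[of "vector [0, 1, 1]"] by (simp add: P0)
  ultimately have P: "P w = w$1 * (a * w$1 + d * w$2 + e * w$3)" for w
    by (simp add: P0 algebra_simps)
  obtain a2 b2 c2 d2 e2 f2 where S2: "\<And>w. S2 w = a2 * (w$1 * w$1) + b2 * (w$2 * w$2) + c2 * (w$3 * w$3)
    + d2 * (w$1 * w$2) + e2 * (w$1 * w$3) + f2 * (w$2 * w$3)"
    using quadratic_form_3_coefficients[OF forms(2)] by blast
  obtain a3 b3 c3 d3 e3 f3 where S3: "\<And>w. S3 w = a3 * (w$1 * w$1) + b3 * (w$2 * w$2) + c3 * (w$3 * w$3)
    + d3 * (w$1 * w$2) + e3 * (w$1 * w$3) + f3 * (w$2 * w$3)"
    using quadratic_form_3_coefficients[OF forms(3)] by blast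
  \<comment> \<open>The part of \<open>S2\<close> divisible by \<open>w\<^sub>1\<close> is \<open>w\<^sub>1 L2\<close>, and likewise for \<open>S3\<close>. The primed
    coefficients collect what the substitution for \<open>v\<^sub>1 w\<^sub>1\<close> adds to \<open>A\<close>, \<open>B\<close> and \<open>C\<close>; the
    remaining terms with \<open>v\<^sub>1\<close> make up \<open>T\<close>, and \<open>h\<close> is the cofactor of \<open>v \<bullet> w\<close>.\<close>
  define L2 where "L2 w = a2 * w$1 + d2 * w$2 + e2 * w$3" for w :: "real^3"
  define L3 where "L3 w = a3 * w$1 + d3 * w$2 + e3 * w$3" for w :: "real^3"
  define A' where "A' w = A w + a * (w$2 * w$2) - w$2 * L2 w" for w
  define B' where "B' w = B w + 2 * a * (w$2 * w$3) - w$3 * L2 w - w$2 * L3 w" for w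
  define C' where "C' w = C w + a * (w$3 * w$3) - w$3 * L3 w" for w
  define Q where "Q s t w = s\<^sup>2 * A' w + s * t * B' w + t\<^sup>2 * C' w" for s t w
  define T where "T s t y z = s * ((b2 - d) * y\<^sup>2 + (f2 - e) * (y * z) + c2 * z\<^sup>2) +
    t * (b3 * y\<^sup>2 + (f3 - d) * (y * z) + (c3 - e) * z\<^sup>2)" for s t y z
  define h where "h v w = v$1 * (a * w$1 + d * w$2 + e * w$3) - a * (v$2 * w$2 + v$3 * w$3) +
    v$2 * L2 w + v$3 * L3 w" for v w :: "real^3"
  have h: "bilinear h"
    by (auto simp: bilinear_def linear_iff h_def L2_def L3_def algebra_simps)
  have F_split: "F v w = v$1 * T (v$2) (v$3) (w$2) (w$3) + Q (v$2) (v$3) w + (v \<bullet> w) * h v w"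
    for v w
    unfolding F_eq P S2 S3 T_def Q_def A'_def B'_def C'_def L2_def L3_def h_def inner_vec_def sum_3
    by (simp add: power2_eq_square algebra_simps)
  have forms': "quadratic_form A'" "quadratic_form B'" "quadratic_form C'"
  proof -
    have "A' = (\<lambda>w. A w + (a * (w$2 * w$2) + ((- a2) * (w$2 * w$1) + ((- d2) * (w$2 * w$2)
        + (- e2) * (w$2 * w$3)))))"
      by (auto simp: A'_def L2_def algebra_simps)
    then show "quadratic_form A'"
      by (simp only:) (intro quadratic_form_add quadratic_form_component_mult forms)
    have "B' = (\<lambda>w. B w + ((2 * a) * (w$2 * w$3) + ((- a2) * (w$3 * w$1) + ((- d2) * (w$3 * w$2)
        + ((- e2) * (w$3 * w$3) + ((- a3) * (w$2 * w$1) + ((- d3) * (w$2 * w$2)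
        + (- e3) * (w$2 * w$3))))))))"
      by (auto simp: B'_def L2_def L3_def algebra_simps)
    then show "quadratic_form B'"
      by (simp only:) (intro quadratic_form_add quadratic_form_component_mult forms)
    have "C' = (\<lambda>w. C w + (a * (w$3 * w$3) + ((- a3) * (w$3 * w$1) + ((- d3) * (w$3 * w$2)
        + (- e3) * (w$3 * w$3)))))"
      by (auto simp: C'_def L3_def algebra_simps)
    then show "quadratic_form C'"
      by (simp only:) (intro quadratic_form_add quadratic_form_component_mult forms)
  qed
  have cont: "isCont (\<lambda>r. Q s t (vector [k * r, y, z])) 0" for s t k y z
  proof -
    have "isCont (\<lambda>r. q (vector [k * r, y, z])) 0" if "quadratic_form q" for q :: "real^3 \<Rightarrow> real"
    proof -
      obtain a b c d e f where "\<And>w. q w = a * (w$1 * w$1) + b * (w$2 * w$2) + c * (w$3 * w$3)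
          + d * (w$1 * w$2) + e * (w$1 * w$3) + f * (w$2 * w$3)"
        using quadratic_form_3_coefficients[OF \<open>quadratic_form q\<close>] by blast
      then show ?thesis by (simp add: vector_3)
    qed
    then show ?thesis
      unfolding Q_def using forms' by (intro continuous_intros) auto
  qed
  have T_zero: "T s t y z = 0" for s t y z
  proof (rule linear_coefficient_zero)
    \<comment> \<open>The pair of \<open>(1 / r, s, t)\<close> and \<open>?w r\<close> lies on the variety; letting \<open>r\<close> tend to \<open>0\<close> from both sides
      makes \<open>T / r\<close> dominate.\<close>
    let ?w = "\<lambda>r. vector [- (s * y + t * z) * r, y, z] :: real^3"
    show "isCont (\<lambda>r. Q s t (?w r)) 0" by (rule cont)
    show "T s t y z * r + r\<^sup>2 * Q s t (?w r) \<ge> 0" for r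
    proof (cases "r = 0")
      case False
      let ?v = "vector [1 / r, s, t] :: real^3"
      have "?v \<bullet> ?w r = 0"
        using False by (simp add: inner_vec_def sum_3 vector_3)
      then have "T s t y z / r + Q s t (?w r) \<ge> 0"
        using nonneg[of ?v "?w r"] by (simp add: F_split vector_3)
      then have "r\<^sup>2 * (T s t y z / r + Q s t (?w r)) \<ge> 0"
        by simp
      then show ?thesis
        using False by (simp add: distrib_left power2_eq_square mult.commute)
    qed simp
  qed
  have Q_nonneg: "Q s t w \<ge> 0" for s t w
  proof -
    have *: "Q s t w \<ge> 0" if "w $ 1 \<noteq> 0" for w
    proof -
      let ?v = "vector [- (s * w$2 + t * w$3) / w$1, s, t] :: real^3"
      have "?v \<bullet> w = 0" using that by (simp add: inner_vec_def sum_3 vector_3)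
      then show ?thesis using nonneg[of ?v w] by (simp add: F_split T_zero vector_3)
    qed
    show ?thesis
    proof (cases "w $ 1 = 0")
      case True
      then have w: "w = vector [0, w$2, w$3]"
        by (simp add: vec_eq_iff forall_3 vector_3)
      \<comment> \<open>The vector \<open>w\<close> is a limit of vectors with nonzero first coordinate; the factor \<open>1\<close> only matches the
        shape of the continuity statement.\<close>
      have "Q s t (vector [1 * 0, w$2, w$3]) \<ge> 0"
        using cont[of s t 1 "w$2" "w$3"] by (rule nonneg_removable) (simp add: * vector_3)
      then show ?thesis by (subst w) simp
    qed (rule *)
  qed
  obtain zs where zs: "\<And>s t w. Q s t w = (\<Sum>(a, b)\<leftarrow>zs. (s * (a \<bullet> w) + t * (b \<bullet> w))\<^sup>2)"
    using psd_pencil_sum_of_squares[OF forms'] Q_nonneg unfolding Q_def by blast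
  define \<beta>s where "\<beta>s = map (\<lambda>(a, b) (v :: real^3) w. v$2 * (a \<bullet> w) + v$3 * (b \<bullet> w)) zs"
  have "\<forall>\<beta>\<in>set \<beta>s. bilinear \<beta>"
    by (auto simp: \<beta>s_def bilinear_def linear_iff inner_add_right algebra_simps)
  moreover have "F v w = (\<Sum>\<beta>\<leftarrow>\<beta>s. (\<beta> v w)\<^sup>2) + (v \<bullet> w) * h v w" for v w
    by (simp add: F_split T_zero zs \<beta>s_def o_def case_prod_unfold)
  ultimately show ?thesis using h by blast
qed

lemma bilinear_compose:
  "bilinear \<beta> \<Longrightarrow> linear f \<Longrightarrow> linear g \<Longrightarrow> bilinear (\<lambda>v w. \<beta> (f v) (g w))"
  by (auto simp: bilinear_def intro: linear_compose[unfolded o_def])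

text \<open>A rotation taking the first unit vector to \<open>v0\<close>, up to its length, preserves \<open>v \<bullet> w\<close> and reduces
  the claim to the case of the first axis.\<close>

theorem sos_modulo_pairing:
  fixes F :: "real^3 \<Rightarrow> real^3 \<Rightarrow> real"
  assumes F: "biquadratic_map F"
    and nonneg: "\<And>v w. v \<bullet> w = 0 \<Longrightarrow> F v w \<ge> 0"
    and v0: "v0 \<noteq> 0" "\<And>w. v0 \<bullet> w = 0 \<Longrightarrow> F v0 w = 0"
  shows "\<exists>\<beta>s h. (\<forall>\<beta>\<in>set \<beta>s. bilinear \<beta>) \<and> bilinear h \<and>
    (\<forall>v w. F v w = (\<Sum>\<beta>\<leftarrow>\<beta>s. (\<beta> v w)\<^sup>2) + (v \<bullet> w) * h v w)"
proof -
  define u where "u = v0 /\<^sub>R norm v0"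
  have "norm u = 1" using v0 by (simp add: u_def)
  then obtain R where R: "orthogonal_matrix R" "R *v axis 1 1 = u"
    using orthogonal_matrix_exists_basis[of u 1] by blast
  define R' where "R' = transpose R"
  have RT: "R *v (R' *v x) = x" "R' *v (R *v x) = x" for x
    using R(1) by (simp_all add: R'_def orthogonal_matrix_def matrix_vector_mul_assoc
        del: transpose_matrix_vector)
  have pairing: "(R *v x) \<bullet> (R *v y) = x \<bullet> y" for x y
  proof -
    have "(R *v x) \<bullet> (R *v y) = (R' *v (R *v x)) \<bullet> y"
      by (simp add: R'_def dot_lmul_matrix)
    then show ?thesis by (simp add: RT)
  qed
  define F' where "F' v w = F (R *v v) (R *v w)" for v w
  have "biquadratic_map F'"
    unfolding F'_def[abs_def]
    by (rule biquadratic_map_compose[OF F matrix_vector_mul_linear matrix_vector_mul_linear])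
  moreover have "F' v w \<ge> 0" if "v \<bullet> w = 0" for v w
    using that by (simp add: F'_def nonneg pairing)
  moreover have "F' (axis 1 1) w = 0" if "w $ 1 = 0" for w
  proof -
    have "u \<bullet> (R *v w) = 0"
      using that pairing[of "axis 1 1" w] by (simp add: R(2) inner_axis')
    then have "F v0 (R *v w) = 0" using v0 by (simp add: u_def)
    moreover have "F u x = (inverse (norm v0))\<^sup>2 * F v0 x" for x
      using F unfolding u_def
      by (induction rule: biquadratic_map.induct)
        (simp_all add: bilinear_lmul power2_eq_square algebra_simps)
    ultimately show ?thesis by (simp add: F'_def R(2))
  qed
  ultimately obtain \<beta>s h where *: "\<forall>\<beta>\<in>set \<beta>s. bilinear \<beta>" "bilinear h"
    "\<And>v w. F' v w = (\<Sum>\<beta>\<leftarrow>\<beta>s. (\<beta> v w)\<^sup>2) + (v \<bullet> w) * h v w"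
    using sos_modulo_pairing_axis by blast
  let ?rot = "\<lambda>\<beta> v w. \<beta> (R' *v v) (R' *v w) :: real"
  have "F v w = (\<Sum>\<beta>\<leftarrow>map ?rot \<beta>s. (\<beta> v w)\<^sup>2) + (v \<bullet> w) * ?rot h v w" for v w
  proof -
    have "F v w = F' (R' *v v) (R' *v w)" by (simp add: F'_def RT)
    moreover have "(R' *v v) \<bullet> (R' *v w) = v \<bullet> w"
      by (metis RT(1) pairing)
    ultimately show ?thesis by (simp add: *(3) o_def)
  qed
  moreover have "\<forall>\<beta>\<in>set (map ?rot \<beta>s). bilinear \<beta>" "bilinear (?rot h)"
    using *(1,2)
      bilinear_compose[OF _ matrix_vector_mul_linear[of R'] matrix_vector_mul_linear[of R']]
    by auto
  ultimately show ?thesis by blast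
qed

section \<open>From functions to polynomials\<close>

lemma digits_unique:
  fixes a b c d N :: nat
  assumes "a + N * b = c + N * d" "a < N" "c < N"
  shows "a = c \<and> b = d"
proof -
  have "a = (a + N * b) mod N" "b = (a + N * b) div N" using assms(2) by auto
  moreover have "c = (c + N * d) mod N" "d = (c + N * d) div N" using assms(3) by auto
  ultimately show ?thesis using assms(1) by metis
qed

lemma prod_3: "prod f (UNIV :: 3 set) = f 1 * f 2 * f 3"
  unfolding UNIV_3 by (simp add: ac_simps)

text \<open>Kronecker substitution: if \<open>N\<close> exceeds every exponent, substituting \<open>t\<close>, \<open>t\<^sup>N\<close>, \<open>t\<close> to the
  power \<open>N\<^sup>2\<close>, and so on for the six variables sends distinct monomials to distinct powers of \<open>t\<close>,
  because the exponents become the digits of a number in base \<open>N\<close>. The claim is thereby reduced to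
  polynomials in one variable.\<close>

lemma poly_eval_zero_imp_zero:
  assumes "\<And>v w. poly_eval p v w = 0"
  shows "p = 0"
proof (rule ccontr)
  assume "p \<noteq> 0"
  then obtain m0 where m0: "m0 \<in> Poly_Mapping.keys p"
    using keys_eq_empty by fastforce
  define N where "N = Suc (\<Sum>m\<in>Poly_Mapping.keys p. \<Sum>i\<in>UNIV. Poly_Mapping.lookup m i)"
  have small: "Poly_Mapping.lookup m i < N" if "m \<in> Poly_Mapping.keys p" for m i
  proof -
    have "Poly_Mapping.lookup m i \<le> (\<Sum>i\<in>UNIV. Poly_Mapping.lookup m i)"
      by (intro member_le_sum) auto
    also have "\<dots> \<le> (\<Sum>m\<in>Poly_Mapping.keys p. \<Sum>i\<in>UNIV. Poly_Mapping.lookup m i)"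
      using that by (intro member_le_sum[of m _ "\<lambda>m. \<Sum>i\<in>UNIV. Poly_Mapping.lookup m i"]) auto
    finally show ?thesis by (simp add: N_def)
  qed
  define code where "code m = Poly_Mapping.lookup m (Inl 1) + N * (Poly_Mapping.lookup m (Inl 2) +
    N * (Poly_Mapping.lookup m (Inl 3) + N * (Poly_Mapping.lookup m (Inr 1) +
    N * (Poly_Mapping.lookup m (Inr 2) + N * Poly_Mapping.lookup m (Inr 3)))))" for m :: monom_xy
  have inj: "m = m'" if m: "m \<in> Poly_Mapping.keys p" "m' \<in> Poly_Mapping.keys p" "code m = code m'" for m m'
  proof -
    note d = digits_unique[OF _ small[OF m(1)] small[OF m(2)]]
    have 1: "Poly_Mapping.lookup m (Inl 1) = Poly_Mapping.lookup m' (Inl 1) \<and>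
       Poly_Mapping.lookup m (Inl 2) = Poly_Mapping.lookup m' (Inl 2) \<and>
       Poly_Mapping.lookup m (Inl 3) = Poly_Mapping.lookup m' (Inl 3) \<and>
       Poly_Mapping.lookup m (Inr 1) = Poly_Mapping.lookup m' (Inr 1) \<and>
       Poly_Mapping.lookup m (Inr 2) = Poly_Mapping.lookup m' (Inr 2) \<and>
       Poly_Mapping.lookup m (Inr 3) = Poly_Mapping.lookup m' (Inr 3)"
      using m(3) unfolding code_def by (blast dest: d)
    show ?thesis
    proof (rule poly_mapping_eqI)
      fix i :: "3 + 3"
      show "Poly_Mapping.lookup m i = Poly_Mapping.lookup m' i"
      proof (cases i)
        case (Inl j)
        then show ?thesis using 1 exhaust_3[of j] by auto
      next
        case (Inr j)
        then show ?thesis using 1 exhaust_3[of j] by auto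
      qed
    qed
  qed
  have eval: "monom_eval m (vector [t, t ^ N, t ^ (N * N)])
      (vector [t ^ (N * N * N), t ^ (N * N * N * N), t ^ (N * N * N * N * N)]) = t ^ code m" for m t
  proof -
    show ?thesis
      unfolding monom_eval_def prod_3 vector_3 code_def power_mult[symmetric] power_add[symmetric]
      by (rule arg_cong[of _ _ "power t"]) (simp add: algebra_simps)
  qed
  define q where "q = (\<Sum>m\<in>Poly_Mapping.keys p. Polynomial.monom (Poly_Mapping.lookup p m) (code m))"
  have "poly q t = 0" for t
    using assms[of "vector [t, t ^ N, t ^ (N * N)]"
      "vector [t ^ (N * N * N), t ^ (N * N * N * N), t ^ (N * N * N * N * N)]"]
    by (simp add: q_def poly_sum poly_monom poly_eval_def eval)
  then have "q = 0" using poly_all_0_iff_0 by blast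
  have "coeff q (code m0) = (\<Sum>m\<in>Poly_Mapping.keys p. if m = m0 then Poly_Mapping.lookup p m0 else 0)"
    unfolding q_def coeff_sum using inj m0 by (intro sum.cong) auto
  also have "\<dots> = Poly_Mapping.lookup p m0" using m0 by simp
  finally show False using m0 \<open>q = 0\<close> by (simp add: in_keys_iff)
qed

lemma poly_eval_inject:
  assumes "\<And>v w. poly_eval p v w = poly_eval q v w"
  shows "p = q"
proof -
  have "poly_eval (p - q) v w = 0" for v w
    using poly_eval_add[of "p - q" q v w] assms[of v w] by simp
  then show ?thesis using poly_eval_zero_imp_zero[of "p - q"] by simp
qed

lemma poly_eval_const: "poly_eval (Poly_Mapping.single 0 c) v w = c"
  by (simp add: poly_eval_single monom_eval_def)

lemma poly_eval_power2: "poly_eval (p\<^sup>2) v w = (poly_eval p v w)\<^sup>2"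
  by (simp add: power2_eq_square poly_eval_mult)

lemma bilinear_poly_eval:
  assumes "bilinear \<beta>"
  shows "\<exists>q. \<forall>v w. poly_eval q v w = \<beta> v w"
  by (rule exI[of _ "\<Sum>i\<in>UNIV. \<Sum>j\<in>UNIV. Poly_Mapping.single 0 (\<beta> (axis i 1) (axis j 1)) * var_x i * var_y j"],
      intro allI, subst bilinear_coordinates[OF assms])
    (simp add: poly_eval_sum poly_eval_mult poly_eval_const mult_ac)

lemma power_product_degree_2:
  fixes e :: "3 \<Rightarrow> nat"
  assumes "(\<Sum>i\<in>UNIV. e i) = 2"
  shows "\<exists>i j. \<forall>x :: real^3. (\<Prod>i\<in>UNIV. (x $ i) ^ e i) = x $ i * x $ j"
proof -
  have "e 1 + e 2 + e 3 = 2" using assms by (simp add: sum_3)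
  then consider "e 1 = 2" "e 2 = 0" "e 3 = 0" | "e 1 = 0" "e 2 = 2" "e 3 = 0"
    | "e 1 = 0" "e 2 = 0" "e 3 = 2" | "e 1 = 1" "e 2 = 1" "e 3 = 0"
    | "e 1 = 1" "e 2 = 0" "e 3 = 1" | "e 1 = 0" "e 2 = 1" "e 3 = 1"
    by force
  then show ?thesis
  proof cases
    case 1
    then show ?thesis by (intro exI[of _ 1]) (simp add: prod_3 power2_eq_square)
  next
    case 2
    then show ?thesis by (intro exI[of _ 2]) (simp add: prod_3 power2_eq_square)
  next
    case 3
    then show ?thesis by (intro exI[of _ 3]) (simp add: prod_3 power2_eq_square)
  next
    case 4
    then show ?thesis by (intro exI[of _ 1] exI[of _ 2]) (simp add: prod_3)
  next
    case 5
    then show ?thesis by (intro exI[of _ 1] exI[of _ 3]) (simp add: prod_3)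
  next
    case 6
    then show ?thesis by (intro exI[of _ 2] exI[of _ 3]) (simp add: prod_3)
  qed
qed

lemma biquadratic_map_poly_eval:
  assumes "biquadratic_form p"
  shows "biquadratic_map (poly_eval p)"
proof -
  have monomial: "biquadratic_map (\<lambda>v w. Poly_Mapping.lookup p m * monom_eval m v w)"
    if m: "m \<in> Poly_Mapping.keys p" for m
  proof -
    obtain i j where ij: "\<And>v :: real^3. (\<Prod>i\<in>UNIV. (v $ i) ^ Poly_Mapping.lookup m (Inl i)) = v $ i * v $ j"
      using power_product_degree_2[of "\<lambda>i. Poly_Mapping.lookup m (Inl i)"] assms m
      by (auto simp: biquadratic_form_def)
    obtain k l where kl: "\<And>w :: real^3. (\<Prod>i\<in>UNIV. (w $ i) ^ Poly_Mapping.lookup m (Inr i)) = w $ k * w $ l"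
      using power_product_degree_2[of "\<lambda>i. Poly_Mapping.lookup m (Inr i)"] assms m
      by (auto simp: biquadratic_form_def)
    have "bilinear (\<lambda>(v :: real^3) (w :: real^3). c * (v $ i * w $ j))" for c i j
      by (auto simp: bilinear_def linear_iff algebra_simps)
    from biquadratic_map.add_product[OF this[of "Poly_Mapping.lookup p m" i k] this[of 1 j l]
        biquadratic_map.zero]
    show ?thesis by (simp add: monom_eval_def ij kl mult_ac)
  qed
  have "biquadratic_map (\<lambda>v w. \<Sum>m\<in>M. Poly_Mapping.lookup p m * monom_eval m v w)"
    if "finite M" "M \<subseteq> Poly_Mapping.keys p" for M
    using that by (induction M) (auto intro: biquadratic_map.zero biquadratic_map_add monomial)
  from this[OF _ order_refl] show ?thesis by (simp add: poly_eval_def[abs_def])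
qed

lemma sum_list_squares_in_sums_of_squares: "(\<Sum>f\<leftarrow>fs. f\<^sup>2) \<in> sums_of_squares"
proof -
  have "(\<Sum>f\<leftarrow>fs. f\<^sup>2) = (\<Sum>i<length fs. (fs ! i)\<^sup>2)"
    by (simp add: sum_list_sum_nth atLeast0LessThan)
  then show ?thesis unfolding sums_of_squares_def by blast
qed

lemma poly_eval_sum_list: "poly_eval (\<Sum>f\<leftarrow>fs. g f) v w = (\<Sum>f\<leftarrow>fs. poly_eval (g f) v w)"
  by (induction fs) (simp_all add: poly_eval_add)

lemma mem_sums_of_squares_plus_ideal:
  assumes "\<forall>\<beta>\<in>set \<beta>s. bilinear \<beta>" "bilinear h"
    and eq: "\<And>v w. poly_eval p v w = (\<Sum>\<beta>\<leftarrow>\<beta>s. (\<beta> v w)\<^sup>2) + (v \<bullet> w) * h v w"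
  shows "p \<in> sums_of_squares + ideal_I"
proof -
  obtain H where H: "\<And>v w. poly_eval H v w = h v w"
    using bilinear_poly_eval[OF assms(2)] by blast
  have "\<forall>\<beta>\<in>set \<beta>s. \<exists>q. \<forall>v w. poly_eval q v w = \<beta> v w"
    using assms(1) bilinear_poly_eval by blast
  then obtain P where P: "\<And>\<beta> v w. \<beta> \<in> set \<beta>s \<Longrightarrow> poly_eval (P \<beta>) v w = \<beta> v w"
    by metis
  have p_eq: "p = (\<Sum>f\<leftarrow>map P \<beta>s. f\<^sup>2) + H * (\<Sum>i\<in>UNIV. var_x i * var_y i)"
  proof (rule poly_eval_inject)
    fix v w
    have "(\<Sum>\<beta>\<leftarrow>\<beta>s. (poly_eval (P \<beta>) v w)\<^sup>2) = (\<Sum>\<beta>\<leftarrow>\<beta>s. (\<beta> v w)\<^sup>2)"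
      using P by (intro arg_cong[of _ _ sum_list] map_cong) auto
    then show "poly_eval p v w = poly_eval ((\<Sum>f\<leftarrow>map P \<beta>s. f\<^sup>2) + H * (\<Sum>i\<in>UNIV. var_x i * var_y i)) v w"
      by (simp add: eq poly_eval_add poly_eval_mult poly_eval_sum poly_eval_sum_list poly_eval_power2 H
          inner_vec_def o_def mult.commute)
  qed
  have "H * (\<Sum>i\<in>UNIV. var_x i * var_y i) \<in> ideal_I"
    unfolding ideal_I_eq by (rule rangeI)
  then show ?thesis
    unfolding p_eq by (intro set_plus_intro sum_list_squares_in_sums_of_squares)
qed

theorem corollary3p11:
  fixes p :: poly_xy
  assumes biquadratic: "biquadratic_form p"
    and nonneg: "\<And>v w. (v, w) \<in> variety ideal_I \<Longrightarrow> poly_eval p v w \<ge> 0"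
    and zeros:
      "(\<exists>v0 w1 w2. v0 \<noteq> 0 \<and> w1 \<noteq> w2 \<and> independent {w1, w2} \<and>
          orthogonal w1 v0 \<and> orthogonal w2 v0 \<and>
          poly_eval p v0 w1 = 0 \<and> poly_eval p v0 w2 = 0) \<or>
       (\<exists>w0 v1 v2. w0 \<noteq> 0 \<and> v1 \<noteq> v2 \<and> independent {v1, v2} \<and>
          orthogonal v1 w0 \<and> orthogonal v2 w0 \<and>
          poly_eval p v1 w0 = 0 \<and> poly_eval p v2 w0 = 0)"
  shows "p \<in> sums_of_squares + ideal_I"
proof -
  have F: "biquadratic_map (poly_eval p)"
    by (rule biquadratic_map_poly_eval[OF biquadratic])
  have pos: "poly_eval p v w \<ge> 0" if "v \<bullet> w = 0" for v w
    using nonneg[of v w] that by (simp add: variety_ideal_I inner_commute)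
  from zeros show ?thesis
  proof (elim disjE exE conjE)
    fix v0 w1 w2
    assume *: "v0 \<noteq> 0" "w1 \<noteq> w2" "independent {w1, w2}" "orthogonal w1 v0" "orthogonal w2 v0"
      "poly_eval p v0 w1 = 0" "poly_eval p v0 w2 = 0"
    from sos_modulo_pairing[OF F pos *(1) biquadratic_map_zero_on_plane[OF F pos *]]
    show ?thesis using mem_sums_of_squares_plus_ideal by blast
  next
    fix w0 v1 v2
    assume *: "w0 \<noteq> 0" "v1 \<noteq> v2" "independent {v1, v2}" "orthogonal v1 w0" "orthogonal v2 w0"
      "poly_eval p v1 w0 = 0" "poly_eval p v2 w0 = 0"
    let ?F = "\<lambda>v w. poly_eval p w v"
    have F': "biquadratic_map ?F" by (rule biquadratic_map_swap[OF F])
    have pos': "?F v w \<ge> 0" if "v \<bullet> w = 0" for v w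
      using pos[of w v] that by (simp add: inner_commute)
    obtain \<beta>s h where \<beta>s: "\<forall>\<beta>\<in>set \<beta>s. bilinear \<beta>" "bilinear h"
      "\<And>v w. ?F v w = (\<Sum>\<beta>\<leftarrow>\<beta>s. (\<beta> v w)\<^sup>2) + (v \<bullet> w) * h v w"
      using sos_modulo_pairing[OF F' pos' *(1) biquadratic_map_zero_on_plane[OF F' pos' *]] by blast
    let ?swap = "\<lambda>\<beta> v w. \<beta> w v :: real"
    show ?thesis
    proof (rule mem_sums_of_squares_plus_ideal)
      show "\<forall>\<beta>\<in>set (map ?swap \<beta>s). bilinear \<beta>" "bilinear (?swap h)"
        using \<beta>s(1,2) by (auto simp: bilinear_def)
      show "poly_eval p v w = (\<Sum>\<beta>\<leftarrow>map ?swap \<beta>s. (\<beta> v w)\<^sup>2) + (v \<bullet> w) * ?swap h v w" for v w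
        by (simp add: \<beta>s(3) o_def inner_commute)
    qed
  qed
qed

end
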